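(* Suppose one observes an unrooted unlabelled BCMRT of size $2n$, and let $\mathbf R^\star_{q_0,q_1}=\mathbf R^\star_{q_0,q_1}(n)$ denote the optimal risk for testing $H_0:q=q_0$ against $H_1:q=q_1$ from this observation. Then, for all $0\le q_0<q_1\le1/2$, $$\sup_{n\ge2}\mathbf R^\star_{q_0,q_1}(n)<\frac12 .$$
   Context: BCMRT$(q)$ (balanced community modulated random recursive tree), $q\in[0,1]$: $T_1$ is a single edge (the root edge) joining two nodes with time-label $1$, one of type $A$, denoted $(1,A)$, and one of type $B$, denoted $(1,B)$. At each step $n\ge 2$, two new nodes with time-label $n$, namely $(n,A)$ of type $A$ and $(n,B)$ of type $B$, are added to the tree $T_{n-1}$ of size $2(n-1)$: (1) the two nodes independently (of each other and of the past) decide to connect to a node of their own type with probability $1-q$, or to a node of the other type with probability $q$; (2) each then independently chooses its parent uniformly among the $n-1$ nodes of $T_{n-1}$ of the selected type and is joined to it by an edge. This yields the tree $T_n$ of size $2n$. The unrooted unlabelled BCMRT of size $2n$ is the tree $T_n$ without types, time labels or knowledge of the root edge; i.e. $T_n$ up to tree isomorphism. A test $\varphi$ is a function from the set of possible observations to $\{0,1\}$; writing $\mathbf P_q$ for the law under BCMRT$(q)$, its risk is $\mathbf R_{q_0,q_1}(\varphi)=\frac12\left(\mathbf P_{q_0}(\varphi=1)+\mathbf P_{q_1}(\varphi=0)\right)$, and $\mathbf R^\star_{q_0,q_1}=\inf_\varphi\mathbf R_{q_0,q_1}(\varphi)$, the infimum being over all tests. *)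

theory Defs
  imports "HOL-Probability.Probability"
begin

datatype community = TypeA | TypeB

fun other :: "community \<Rightarrow> community" where
  "other TypeA = TypeB"
| "other TypeB = TypeA"

text \<open>A node is a pair (time label, type). A simple graph is a vertex set together with a
  set of edges, an edge being the set of its two endpoints.\<close>

type_synonym node = "nat \<times> community"
type_synonym 'a graph = "'a set \<times> 'a set set"

definition nodes_of_type :: "nat \<Rightarrow> community \<Rightarrow> node set" where
  "nodes_of_type n c = {1..n} \<times> {c}"

definition choose_type :: "real \<Rightarrow> community \<Rightarrow> community pmf" where
  "choose_type q c = map_pmf (\<lambda>b. if b then other c else c) (bernoulli_pmf q)"

text \<open>The random edge set of the labelled tree with \<open>2 * n\<close> nodes; its vertex set
  \<open>{1..n} \<times> UNIV\<close> is deterministic. The size \<open>n = 0\<close> is a dummy case.\<close>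

fun bcmrt_edges :: "real \<Rightarrow> nat \<Rightarrow> node set set pmf" where
  "bcmrt_edges q 0 = return_pmf {}"
| "bcmrt_edges q (Suc 0) = return_pmf {{(1, TypeA), (1, TypeB)}}"
| "bcmrt_edges q (Suc (Suc m)) = do {
     E \<leftarrow> bcmrt_edges q (Suc m);
     cA \<leftarrow> choose_type q TypeA;
     cB \<leftarrow> choose_type q TypeB;
     u \<leftarrow> pmf_of_set (nodes_of_type (Suc m) cA);
     v \<leftarrow> pmf_of_set (nodes_of_type (Suc m) cB);
     return_pmf (E \<union> {{(Suc (Suc m), TypeA), u}, {(Suc (Suc m), TypeB), v}})
   }"

definition bcmrt :: "real \<Rightarrow> nat \<Rightarrow> node graph pmf" where
  "bcmrt q n = map_pmf (\<lambda>E. ({1..n} \<times> UNIV, E)) (bcmrt_edges q n)"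

definition graph_isomorphic :: "'a graph \<Rightarrow> 'b graph \<Rightarrow> bool" where
  "graph_isomorphic G H \<longleftrightarrow>
     (\<exists>f. bij_betw f (fst G) (fst H) \<and> (\<lambda>e. f ` e) ` snd G = snd H)"

text \<open>Forgetting types, time labels and root edge: a graph is replaced by its isomorphism
  class among all graphs on vertices drawn from \<^typ>\<open>node\<close>.\<close>

definition unlabelled :: "node graph \<Rightarrow> node graph set" where
  "unlabelled G = {H. graph_isomorphic G H}"

definition unlabelled_bcmrt :: "real \<Rightarrow> nat \<Rightarrow> node graph set pmf" where
  "unlabelled_bcmrt q n = map_pmf unlabelled (bcmrt q n)"

text \<open>Tests are \<^typ>\<open>bool\<close>-valued, \<open>True\<close> standing for 1 (deciding for \<open>q = q1\<close>) and \<open>False\<close>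
  for 0. Their values outside the possible observations do not affect the risk.\<close>

definition risk :: "real \<Rightarrow> real \<Rightarrow> nat \<Rightarrow> (node graph set \<Rightarrow> bool) \<Rightarrow> real" where
  "risk q0 q1 n \<phi> =
     1 / 2 * (measure_pmf.prob (unlabelled_bcmrt q0 n) {t. \<phi> t}
            + measure_pmf.prob (unlabelled_bcmrt q1 n) {t. \<not> \<phi> t})"

definition optimal_risk :: "real \<Rightarrow> real \<Rightarrow> nat \<Rightarrow> real" where
  "optimal_risk q0 q1 n = (INF \<phi>. risk q0 q1 n \<phi>)"

text \<open>The sets under the infimum above and under suprema of \<^const>\<open>optimal_risk\<close> are bounded,
  so these are the genuine infimum and supremum of real numbers.\<close>

lemma risk_nonneg: "0 \<le> risk q0 q1 n \<phi>"
  by (simp add: risk_def)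

lemma bdd_below_risk: "bdd_below (range (risk q0 q1 n))"
  by (rule bdd_belowI[of _ 0]) (auto simp: risk_nonneg)

lemma optimal_risk_nonneg: "0 \<le> optimal_risk q0 q1 n"
  unfolding optimal_risk_def by (rule cINF_greatest) (auto simp: risk_nonneg)

lemma optimal_risk_le_half: "optimal_risk q0 q1 n \<le> 1 / 2"
proof -
  have "optimal_risk q0 q1 n \<le> risk q0 q1 n (\<lambda>_. True)"
    unfolding optimal_risk_def by (rule cINF_lower[OF bdd_below_risk]) simp
  also have "\<dots> = 1 / 2"
    using measure_pmf.prob_space[of "unlabelled_bcmrt q0 n"] by (simp add: risk_def)
  finally show ?thesis .
qed

lemma bdd_above_optimal_risk: "bdd_above (optimal_risk q0 q1 ` N)"
  using optimal_risk_le_half by (intro bdd_aboveI[of _ "1 / 2"]) blast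

end

theory Submission
  imports Defs
begin


text \<open>
  The total variation distance between the two laws is bounded below through one statistic,
  the Wiener index \<open>W\<close> (the sum of all distances).
  Put \<open>\<theta> = 1 - 2 q\<close>, and let \<open>G\<close> be the sum of \<open>\<sigma>(x) \<sigma>(y) d(x, y)\<close> with
  \<open>\<sigma> = 1\<close> on type \<open>A\<close> and \<open>\<sigma> = -1\<close> on type \<open>B\<close>. The expectations of \<open>W\<close> and \<open>- G\<close>
  satisfy a closed linear recursion whose coefficients are nonnegative and increasing in \<open>\<theta>\<close>, so the means
  of \<open>W\<close> under \<open>q0\<close> and \<open>q1\<close> differ by at least \<open>c n (n + 1)\<close> for all \<open>n \<ge> 2\<close>. On the other hand
  \<open>W\<close>, centred by a deterministic sequence not depending on \<open>q\<close> and divided by \<open>n (n + 1)\<close>, is a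
  martingale up to summable errors: its increments are controlled by the squared depths, whose
  average is \<open>O(\<surd>n)\<close> in expectation. Hence its second moment is bounded uniformly in
  \<open>n\<close> and \<open>q\<close>, and a mean shift with bounded second moments forces a positive total variation distance.
\<close>

section \<open>Graph distance and Wiener index\<close>

text \<open>Allowing idle steps does not change distances, and it lets walks be pushed forward along
  non-injective vertex maps.\<close>

definition step_rel :: "'a set set \<Rightarrow> ('a \<times> 'a) set" where
  "step_rel E = {(x, y). {x, y} \<in> E} \<union> Id"

text \<open>The \<open>LEAST\<close> is meaningful only when some walk exists, which
  \<open>connected_graph\<close> ensures.\<close>

definition gdist :: "'a set set \<Rightarrow> 'a \<Rightarrow> 'a \<Rightarrow> nat" where
  "gdist E x y = (LEAST k. (x, y) \<in> step_rel E ^^ k)"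

text \<open>Edges must also stay inside the vertex set, so that a vertex outside it meets no edge
  before it is attached as a leaf.\<close>

definition connected_graph :: "'a graph \<Rightarrow> bool" where
  "connected_graph G \<longleftrightarrow>
     snd G \<subseteq> Pow (fst G) \<and> (\<forall>x\<in>fst G. \<forall>y\<in>fst G. \<exists>k. (x, y) \<in> step_rel (snd G) ^^ k)"

lemma step_rel_refl [simp]: "(x, x) \<in> step_rel E"
  by (simp add: step_rel_def)

lemma relpow_step_rel_sym: "(x, y) \<in> step_rel E ^^ k \<Longrightarrow> (y, x) \<in> step_rel E ^^ k"
proof (induction k arbitrary: y)
  case (Suc k)
  then obtain z where z: "(x, z) \<in> step_rel E ^^ k" "(z, y) \<in> step_rel E"
    by auto
  moreover have "(y, z) \<in> step_rel E"
    using z(2) by (auto simp: step_rel_def insert_commute)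
  ultimately show ?case
    using Suc.IH by (meson relpow_Suc_I2)
qed simp

lemma relpow_step_rel_Suc: "(x, y) \<in> step_rel E ^^ k \<Longrightarrow> (x, y) \<in> step_rel E ^^ Suc k"
  by (meson relpow_Suc_I step_rel_refl)

lemma relpow_map:
  assumes "\<And>x y. (x, y) \<in> R \<Longrightarrow> (f x, f y) \<in> S" and "(x, y) \<in> R ^^ k"
  shows "(f x, f y) \<in> S ^^ k"
  using assms(2)
proof (induction k arbitrary: y)
  case (Suc k)
  then show ?case
    using assms(1) by (metis relpow_Suc_E relpow_Suc_I)
qed simp

lemma gdist_le: "(x, y) \<in> step_rel E ^^ k \<Longrightarrow> gdist E x y \<le> k"
  unfolding gdist_def by (rule Least_le)

lemma gdist_sym: "gdist E x y = gdist E y x"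
  unfolding gdist_def by (metis relpow_step_rel_sym)

lemma gdist_self [simp]: "gdist E x x = 0"
  using gdist_le[of x x 0 E] by simp

lemma connected_graph_gdist:
  assumes "connected_graph (V, E)" "x \<in> V" "y \<in> V"
  shows "(x, y) \<in> step_rel E ^^ gdist E x y"
proof -
  have "\<exists>k. (x, y) \<in> step_rel E ^^ k"
    using assms by (simp add: connected_graph_def)
  then show ?thesis
    unfolding gdist_def by (rule LeastI_ex)
qed

lemma gdist_triangle:
  assumes "connected_graph (V, E)" "x \<in> V" "y \<in> V" "z \<in> V"
  shows "gdist E x z \<le> gdist E x y + gdist E y z"
  using connected_graph_gdist[OF assms(1-3)] connected_graph_gdist[OF assms(1,3,4)]
  by (intro gdist_le) (auto simp: relpow_add)

lemma step_rel_image: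
  assumes "\<And>e. e \<in> E \<Longrightarrow> f ` e \<in> F" and "(x, y) \<in> step_rel E"
  shows "(f x, f y) \<in> step_rel F"
  using assms(1)[of "{x, y}"] assms(2) by (auto simp: step_rel_def)

text \<open>Walks of each length correspond, pushed forward by \<open>f\<close> and pulled back by
  its inverse, so the least lengths agree. \<open>E \<subseteq> Pow V\<close> lets the inverse undo
  \<open>f\<close> on whole edges.\<close>

lemma gdist_isomorphism:
  assumes f: "bij_betw f V W" and EF: "(\<lambda>e. f ` e) ` E = F" and E: "E \<subseteq> Pow V"
    and xy: "x \<in> V" "y \<in> V"
  shows "gdist F (f x) (f y) = gdist E x y"
proof -
  define g where "g = inv_into V f"
  have g: "g (f z) = z" if "z \<in> V" for z
    using f that by (simp add: g_def bij_betw_def)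
  have gF: "g ` e \<in> E" if e: "e \<in> F" for e
  proof -
    obtain e' where e': "e' \<in> E" "e = f ` e'"
      using e unfolding EF[symmetric] by blast
    then have "g ` e = e'"
      using E f inv_into_image_cancel[of f V e'] unfolding g_def bij_betw_def by blast
    then show ?thesis using e' by simp
  qed
  have "(x, y) \<in> step_rel E ^^ k \<longleftrightarrow> (f x, f y) \<in> step_rel F ^^ k" for k
  proof
    assume "(x, y) \<in> step_rel E ^^ k"
    then show "(f x, f y) \<in> step_rel F ^^ k"
      by (rule relpow_map[rotated]) (erule step_rel_image[rotated], use EF in blast)
  next
    assume "(f x, f y) \<in> step_rel F ^^ k"
    then have "(g (f x), g (f y)) \<in> step_rel E ^^ k"
      by (rule relpow_map[rotated]) (erule step_rel_image[rotated], rule gF)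
    then show "(x, y) \<in> step_rel E ^^ k"
      using g xy by simp
  qed
  then show ?thesis
    by (simp add: gdist_def)
qed

text \<open>The retraction sending the new leaf \<open>a\<close> to its neighbour shows that old distances do not shrink.\<close>

lemma relpow_leaf_retract:
  assumes "E \<subseteq> Pow V" "a \<notin> V" "u \<in> V" "x \<noteq> a" "y \<noteq> a"
    and "(x, y) \<in> step_rel (insert {a, u} E) ^^ k"
  shows "(x, y) \<in> step_rel E ^^ k"
proof -
  let ?r = "id(a := u)"
  have "(?r x, ?r y) \<in> step_rel E ^^ k"
    by (rule relpow_map[OF _ assms(6)]) (use assms(1-3) in \<open>auto simp: step_rel_def doubleton_eq_iff\<close>)
  then show ?thesis
    using assms by simp
qed

lemma step_rel_mono: "E \<subseteq> F \<Longrightarrow> step_rel E \<subseteq> step_rel F"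
  by (auto simp: step_rel_def)

lemma relpow_step_rel_mono: "E \<subseteq> F \<Longrightarrow> (x, y) \<in> step_rel E ^^ k \<Longrightarrow> (x, y) \<in> step_rel F ^^ k"
  using relpow_map[of "step_rel E" "\<lambda>z. z" "step_rel F"] step_rel_mono[of E F] by (simp add: subset_iff)

text \<open>From the leaf a walk can only idle or step to \<open>u\<close>. Idling is matched by
  padding the shorter walk; after the step, the retraction removes the new edge from the rest. The
  lost step is the extra 1 in distances from \<open>a\<close>.\<close>

lemma relpow_leaf:
  assumes "E \<subseteq> Pow V" "a \<notin> V" "u \<in> V" "y \<noteq> a"
    and "(a, y) \<in> step_rel (insert {a, u} E) ^^ k"
  shows "\<exists>j. k = Suc j \<and> (u, y) \<in> step_rel E ^^ j"
  using assms(5)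
proof (induction k)
  case 0
  then show ?case using assms(4) by simp
next
  case (Suc k)
  then obtain z where z: "(a, z) \<in> step_rel (insert {a, u} E)"
    "(z, y) \<in> step_rel (insert {a, u} E) ^^ k"
    by (meson relpow_Suc_D2)
  have "z = a \<or> z = u"
    using z(1) assms(1,2) unfolding step_rel_def by (fastforce simp: doubleton_eq_iff)
  then show ?case
  proof
    assume "z = a"
    then show ?thesis
      using Suc.IH z(2) relpow_step_rel_Suc[of u y _ E] by auto
  next
    assume "z = u"
    moreover have "u \<noteq> a" using assms(2,3) by blast
    ultimately show ?thesis
      using relpow_leaf_retract[OF assms(1-3) _ assms(4)] z(2) by blast
  qed
qed

text \<open>Old walks survive in the larger graph and the retraction brings new ones back, so the
  old metric is unchanged. Connectivity follows by routing every pair through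
  \<open>u\<close>.\<close>

lemma add_leaf:
  assumes G: "connected_graph (V, E)" and a: "a \<notin> V" and u: "u \<in> V"
  defines "F \<equiv> insert {a, u} E"
  shows "connected_graph (insert a V, F)" (is ?conn)
    and "\<And>x y. x \<in> V \<Longrightarrow> y \<in> V \<Longrightarrow> gdist F x y = gdist E x y"
    and "\<And>y. y \<in> V \<Longrightarrow> gdist F a y = Suc (gdist E u y)"
proof -
  have E: "E \<subseteq> Pow V" using G by (simp add: connected_graph_def)
  have EF: "E \<subseteq> F" by (auto simp: F_def)
  have old: "(x, y) \<in> step_rel F ^^ k \<longleftrightarrow> (x, y) \<in> step_rel E ^^ k" if "x \<in> V" "y \<in> V" for x y k
    using relpow_leaf_retract[OF E a u, of x y k] relpow_step_rel_mono[OF EF] that a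
    by (auto simp: F_def)
  show "\<And>x y. x \<in> V \<Longrightarrow> y \<in> V \<Longrightarrow> gdist F x y = gdist E x y"
    unfolding gdist_def using old by simp
  have au: "(a, u) \<in> step_rel F"
    by (simp add: step_rel_def F_def)
  have new: "(a, y) \<in> step_rel F ^^ Suc (gdist E u y)" if "y \<in> V" for y
    using au relpow_step_rel_mono[OF EF connected_graph_gdist[OF G u that]]
    by (meson relpow_Suc_I2)
  show "gdist F a y = Suc (gdist E u y)" if y: "y \<in> V" for y
  proof (rule antisym)
    show "gdist F a y \<le> Suc (gdist E u y)"
      using new[OF y] by (rule gdist_le)
    have "(a, y) \<in> step_rel F ^^ gdist F a y"
      unfolding gdist_def using new[OF y] by (rule LeastI)
    moreover have "y \<noteq> a" using y a by blast
    ultimately obtain j where "gdist F a y = Suc j" "(u, y) \<in> step_rel E ^^ j"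
      using relpow_leaf[OF E a u] unfolding F_def by blast
    then show "Suc (gdist E u y) \<le> gdist F a y"
      using gdist_le by fastforce
  qed
  have "\<exists>k. (x, y) \<in> step_rel F ^^ k" if xy: "x \<in> insert a V" "y \<in> insert a V" for x y
  proof -
    have to_u: "\<exists>k. (z, u) \<in> step_rel F ^^ k" if "z \<in> insert a V" for z
      using that new[OF u] relpow_step_rel_mono[OF EF connected_graph_gdist[OF G _ u]] by blast
    obtain k l where "(x, u) \<in> step_rel F ^^ k" "(y, u) \<in> step_rel F ^^ l"
      using to_u xy by blast
    then have "(x, y) \<in> step_rel F ^^ (k + l)"
      using relpow_step_rel_sym[of y u] by (auto simp: relpow_add)
    then show ?thesis by blast
  qed
  then show ?conn
    using E u by (auto simp: connected_graph_def F_def)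
qed

text \<open>Attach \<open>b\<close>, then \<open>a\<close>. Both parents are old vertices, so
  neither leaf hangs from the other and their distance gains 2.\<close>

lemma add_two_leaves:
  assumes G: "connected_graph (V, E)" and ab: "a \<notin> V" "b \<notin> V" "a \<noteq> b" and uv: "u \<in> V" "v \<in> V"
  defines "F \<equiv> E \<union> {{a, u}, {b, v}}"
  shows "connected_graph (insert a (insert b V), F)"
    and "\<And>x y. x \<in> V \<Longrightarrow> y \<in> V \<Longrightarrow> gdist F x y = gdist E x y"
    and "\<And>y. y \<in> V \<Longrightarrow> gdist F a y = gdist E u y + 1"
    and "\<And>y. y \<in> V \<Longrightarrow> gdist F b y = gdist E v y + 1"
    and "gdist F a b = gdist E u v + 2"
proof -
  note A = add_leaf[OF G ab(2) uv(2)]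
  have a: "a \<notin> insert b V" and u: "u \<in> insert b V" using ab uv by auto
  note B = add_leaf[OF A(1) a u]
  have F: "F = insert {a, u} (insert {b, v} E)" by (auto simp: F_def)
  show "connected_graph (insert a (insert b V), F)" using B(1) F by simp
  show "\<And>x y. x \<in> V \<Longrightarrow> y \<in> V \<Longrightarrow> gdist F x y = gdist E x y" using A(2) B(2) F by simp
  show "\<And>y. y \<in> V \<Longrightarrow> gdist F a y = gdist E u y + 1" using A(2) B(3) F uv by simp
  show "\<And>y. y \<in> V \<Longrightarrow> gdist F b y = gdist E v y + 1" using A(3) B(2) F uv by simp
  have "gdist F a b = Suc (gdist (insert {b, v} E) b u)"
    using B(3)[of b] F by (simp add: gdist_sym)
  then show "gdist F a b = gdist E u v + 2"
    using A(3)[of u] uv by (simp add: gdist_sym)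
qed

section \<open>Weighted Wiener indices\<close>

text \<open>The sum runs over ordered pairs, so weight 1 gives twice the usual Wiener index.\<close>

definition weighted_wiener :: "('a \<Rightarrow> real) \<Rightarrow> 'a graph \<Rightarrow> real" where
  "weighted_wiener s G = (\<Sum>x\<in>fst G. \<Sum>y\<in>fst G. s x * s y * real (gdist (snd G) x y))"

abbreviation wiener :: "'a graph \<Rightarrow> real" where
  "wiener \<equiv> weighted_wiener (\<lambda>_. 1)"

text \<open>The row and the column of each new leaf agree by symmetry, hence the factors 2; the
  diagonal contributes nothing.\<close>

lemma weighted_wiener_add_two_leaves:
  assumes G: "connected_graph (V, E)" and ab: "a \<notin> V" "b \<notin> V" "a \<noteq> b" and uv: "u \<in> V" "v \<in> V"
    and V: "finite V"
  shows "weighted_wiener s (insert a (insert b V), E \<union> {{a, u}, {b, v}}) =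
    weighted_wiener s (V, E)
      + 2 * s a * (\<Sum>w\<in>V. s w * (real (gdist E u w) + 1))
      + 2 * s b * (\<Sum>w\<in>V. s w * (real (gdist E v w) + 1))
      + 2 * s a * s b * (real (gdist E u v) + 2)"
proof -
  define F where "F = E \<union> {{a, u}, {b, v}}"
  note D = add_two_leaves[OF G ab uv, folded F_def]
  define f where "f x y = s x * s y * real (gdist F x y)" for x y
  have fsym: "f x y = f y x" for x y
    by (simp add: f_def gdist_sym)
  have faa: "f x x = 0" for x
    by (simp add: f_def)
  have "weighted_wiener s (insert a (insert b V), F) =
     (\<Sum>x\<in>insert a (insert b V). \<Sum>y\<in>insert a (insert b V). f x y)"
    by (simp add: weighted_wiener_def f_def)
  also have "\<dots> = (\<Sum>x\<in>V. \<Sum>y\<in>V. f x y) + 2 * (\<Sum>y\<in>V. f a y) + 2 * (\<Sum>y\<in>V. f b y) + 2 * f a b"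
  proof -
    have "(\<Sum>x\<in>V. f x a) = (\<Sum>x\<in>V. f a x)" "(\<Sum>x\<in>V. f x b) = (\<Sum>x\<in>V. f b x)" "f b a = f a b"
      using fsym by auto
    then show ?thesis
      using ab V by (simp add: sum.distrib faa)
  qed
  also have "(\<Sum>x\<in>V. \<Sum>y\<in>V. f x y) = weighted_wiener s (V, E)"
    unfolding weighted_wiener_def f_def using D(2) by (auto intro!: sum.cong)
  also have "(\<Sum>y\<in>V. f a y) = s a * (\<Sum>w\<in>V. s w * (real (gdist E u w) + 1))"
    unfolding f_def sum_distrib_left using D(3) by (auto intro!: sum.cong)
  also have "(\<Sum>y\<in>V. f b y) = s b * (\<Sum>w\<in>V. s w * (real (gdist E v w) + 1))"
    unfolding f_def sum_distrib_left using D(4) by (auto intro!: sum.cong)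
  also have "f a b = s a * s b * (real (gdist E u v) + 2)"
    using D(5) by (simp add: f_def)
  finally show ?thesis by (simp add: F_def mult.assoc)
qed

text \<open>This makes \<open>W\<close> a legitimate statistic of the unlabelled tree. Spin weights
  would not survive an isomorphism, so \<open>G\<close> serves only in the analysis.\<close>

lemma wiener_isomorphic:
  assumes "graph_isomorphic G H" "snd G \<subseteq> Pow (fst G)"
  shows "wiener H = wiener G"
proof -
  obtain f where f: "bij_betw f (fst G) (fst H)" "(\<lambda>e. f ` e) ` snd G = snd H"
    using assms(1) by (auto simp: graph_isomorphic_def)
  have "wiener H = (\<Sum>x\<in>fst H. \<Sum>y\<in>fst G. real (gdist (snd H) x (f y)))"
    unfolding weighted_wiener_def mult_1
    by (intro sum.cong refl sum.reindex_bij_betw[OF f(1), symmetric])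
  also have "\<dots> = (\<Sum>x\<in>fst G. \<Sum>y\<in>fst G. real (gdist (snd H) (f x) (f y)))"
    by (rule sum.reindex_bij_betw[OF f(1), symmetric])
  also have "\<dots> = wiener G"
    unfolding weighted_wiener_def mult_1
    by (intro sum.cong refl arg_cong[of _ _ real] gdist_isomorphism[OF f assms(2)])
  finally show ?thesis .
qed

section \<open>One growth step\<close>

definition vertices :: "nat \<Rightarrow> node set" where
  "vertices n = {1..n} \<times> UNIV"

definition spin :: "node \<Rightarrow> real" where
  "spin w = (case snd w of TypeA \<Rightarrow> 1 | TypeB \<Rightarrow> -1)"

lemma UNIV_community: "UNIV = {TypeA, TypeB}"
  using community.exhaust by auto

lemma finite_vertices [simp]: "finite (vertices n)"
  by (simp add: vertices_def UNIV_community)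

lemma card_vertices [simp]: "card (vertices n) = 2 * n"
  by (simp add: vertices_def UNIV_community card_cartesian_product)

lemma sum_vertices: "sum f (vertices n) = (\<Sum>i=1..n. f (i, TypeA) + f (i, TypeB))"
  unfolding vertices_def sum.cartesian_product' by (simp add: UNIV_community)

text \<open>Balance of the communities: it makes the parent weights sum to 1 for every
  \<open>\<theta>\<close>.\<close>

lemma sum_spin [simp]: "sum spin (vertices n) = 0"
  by (simp add: sum_vertices spin_def)

lemma vertices_Suc:
  "vertices (Suc n) = insert (Suc n, TypeA) (insert (Suc n, TypeB) (vertices n))"
  by (auto simp: vertices_def UNIV_community le_Suc_eq)

lemma new_notin_vertices [simp]: "(Suc n, c) \<notin> vertices n"
  by (simp add: vertices_def)

lemma spin_cases: "spin w = 1 \<or> spin w = -1"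
  by (auto simp: spin_def split: community.split)

text \<open>Averaging over the parents \<open>u\<close> of \<open>(m + 1, A)\<close> and \<open>v\<close> of \<open>(m + 1, B)\<close>,
  where \<open>\<theta> = 1 - 2 q\<close>.\<close>

definition parent_avg :: "real \<Rightarrow> nat \<Rightarrow> (node \<Rightarrow> node \<Rightarrow> real) \<Rightarrow> real" where
  "parent_avg \<theta> m F = (\<Sum>u\<in>vertices m. \<Sum>v\<in>vertices m.
     (1 + \<theta> * spin u) / (2 * real m) * ((1 - \<theta> * spin v) / (2 * real m)) * F u v)"

lemma parent_avg_add:
  "parent_avg \<theta> m (\<lambda>u v. F u v + F' u v) = parent_avg \<theta> m F + parent_avg \<theta> m F'"
  by (simp add: parent_avg_def distrib_left sum.distrib)

lemma parent_avg_cmult: "parent_avg \<theta> m (\<lambda>u v. c * F u v) = c * parent_avg \<theta> m F"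
  by (simp add: parent_avg_def sum_distrib_left mult_ac)

lemma parent_avg_cong:
  assumes "\<And>u v. u \<in> vertices m \<Longrightarrow> v \<in> vertices m \<Longrightarrow> F u v = F' u v"
  shows "parent_avg \<theta> m F = parent_avg \<theta> m F'"
  unfolding parent_avg_def using assms by (auto intro!: sum.cong)

text \<open>The bound on \<open>\<theta>\<close> makes all weights nonnegative.\<close>

lemma parent_avg_mono:
  assumes "\<bar>\<theta>\<bar> \<le> 1" "\<And>u v. u \<in> vertices m \<Longrightarrow> v \<in> vertices m \<Longrightarrow> F u v \<le> F' u v"
  shows "parent_avg \<theta> m F \<le> parent_avg \<theta> m F'"
  unfolding parent_avg_def
proof (intro sum_mono mult_left_mono assms mult_nonneg_nonneg divide_nonneg_nonneg)
  fix u v :: node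
  show "0 \<le> 1 + \<theta> * spin u" "0 \<le> 1 - \<theta> * spin v"
    using assms(1) spin_cases[of u] spin_cases[of v] by auto
qed auto

lemma sum_affine_spin:
  assumes "m \<ge> 1"
  shows "(\<Sum>u\<in>vertices m. (1 + \<theta> * spin u) / (2 * real m)) = 1"
  using assms by (simp add: sum_divide_distrib[symmetric] sum.distrib sum_distrib_left[symmetric])

lemma parent_avg_fst:
  assumes "m \<ge> 1"
  shows "parent_avg \<theta> m (\<lambda>u v. f u) = (\<Sum>u\<in>vertices m. (1 + \<theta> * spin u) / (2 * real m) * f u)"
proof -
  have "parent_avg \<theta> m (\<lambda>u v. f u) = (\<Sum>u\<in>vertices m. (1 + \<theta> * spin u) / (2 * real m) * f u *
      (\<Sum>v\<in>vertices m. (1 + (- \<theta>) * spin v) / (2 * real m)))"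
    unfolding parent_avg_def by (simp add: sum_distrib_left mult_ac)
  then show ?thesis
    unfolding sum_affine_spin[OF assms] by simp
qed

lemma parent_avg_snd:
  assumes "m \<ge> 1"
  shows "parent_avg \<theta> m (\<lambda>u v. f v) = (\<Sum>v\<in>vertices m. (1 - \<theta> * spin v) / (2 * real m) * f v)"
proof -
  have "parent_avg \<theta> m (\<lambda>u v. f v) = (\<Sum>v\<in>vertices m. (1 - \<theta> * spin v) / (2 * real m) * f v *
      (\<Sum>u\<in>vertices m. (1 + \<theta> * spin u) / (2 * real m)))"
    unfolding parent_avg_def by (subst sum.swap) (simp add: sum_distrib_left mult_ac)
  then show ?thesis
    unfolding sum_affine_spin[OF assms] by simp
qed

lemma parent_avg_const: "m \<ge> 1 \<Longrightarrow> parent_avg \<theta> m (\<lambda>u v. c) = c"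
  unfolding parent_avg_fst sum_distrib_right[symmetric] by (simp only: sum_affine_spin mult_1)

text \<open>The new nodes have opposite types, so the \<open>\<theta>\<close> terms of the two
  marginals cancel. Independence of \<open>q\<close> here is what permits one centring sequence for
  all \<open>q\<close>.\<close>

lemma parent_avg_plus:
  assumes "m \<ge> 1"
  shows "parent_avg \<theta> m (\<lambda>u v. f u + f v) = sum f (vertices m) / m"
  unfolding parent_avg_add parent_avg_fst[OF assms] parent_avg_snd[OF assms]
    sum.distrib[symmetric] sum_divide_distrib
  by (intro sum.cong) (use assms in \<open>auto simp: field_simps\<close>)

text \<open>Now the uniform parts cancel and only the spin parts remain.\<close>

lemma parent_avg_minus:
  assumes "m \<ge> 1"
  shows "parent_avg \<theta> m (\<lambda>u v. f u - f v) = \<theta> * (\<Sum>w\<in>vertices m. spin w * f w) / m"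
proof -
  have "parent_avg \<theta> m (\<lambda>u v. f u - f v) =
      parent_avg \<theta> m (\<lambda>u v. f u) + parent_avg \<theta> m (\<lambda>u v. - f v)"
    by (simp add: parent_avg_add[symmetric])
  then show ?thesis
    unfolding parent_avg_fst[OF assms] parent_avg_snd[OF assms]
      sum.distrib[symmetric] sum_divide_distrib sum_distrib_left
    by (simp, intro sum.cong) (use assms in \<open>auto simp: field_simps\<close>)
qed

text \<open>The parents are independent, so their weights multiply. The terms linear in
  \<open>\<theta>\<close> cancel by symmetry of the distance. The \<open>\<theta>\<^sup>2\<close>
  term is how \<open>q\<close> enters the mean of \<open>W\<close>.\<close>

lemma parent_avg_gdist:
  assumes "m \<ge> 1"
  shows "parent_avg \<theta> m (\<lambda>u v. real (gdist E u v)) =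
    (wiener (vertices m, E) - \<theta>\<^sup>2 * weighted_wiener spin (vertices m, E)) / (4 * (real m)\<^sup>2)"
proof -
  let ?d = "\<lambda>u v. real (gdist E u v)" and ?V = "vertices m"
  have sym: "(\<Sum>u\<in>?V. \<Sum>v\<in>?V. spin v * ?d u v) = (\<Sum>u\<in>?V. \<Sum>v\<in>?V. spin u * ?d u v)"
    by (subst sum.swap) (simp add: gdist_sym)
  have "(1 + \<theta> * spin u) / (2 * real m) * ((1 - \<theta> * spin v) / (2 * real m)) * ?d u v =
      (?d u v + \<theta> * (spin u * ?d u v) - \<theta> * (spin v * ?d u v)
        - \<theta>\<^sup>2 * (spin u * spin v * ?d u v)) / (4 * (real m)\<^sup>2)" for u v
    using assms by (simp add: field_simps power2_eq_square)
  then have "parent_avg \<theta> m ?d = ((\<Sum>u\<in>?V. \<Sum>v\<in>?V. ?d u v) + \<theta> * (\<Sum>u\<in>?V. \<Sum>v\<in>?V. spin u * ?d u v)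
        - \<theta> * (\<Sum>u\<in>?V. \<Sum>v\<in>?V. spin v * ?d u v)
        - \<theta>\<^sup>2 * (\<Sum>u\<in>?V. \<Sum>v\<in>?V. spin u * spin v * ?d u v)) / (4 * (real m)\<^sup>2)"
    unfolding parent_avg_def
    by (simp add: sum_divide_distrib[symmetric] sum.distrib sum_subtractf sum_distrib_left)
  then show ?thesis
    unfolding sym by (simp add: weighted_wiener_def)
qed

definition grow :: "nat \<Rightarrow> node set set \<Rightarrow> node \<Rightarrow> node \<Rightarrow> node set set" where
  "grow m E u v = E \<union> {{(Suc m, TypeA), u}, {(Suc m, TypeB), v}}"

definition root_node :: node where "root_node = (1, TypeA)"

text \<open>A device of the analysis: the root is not visible in the observation. It controls the
  increments of the normalized index.\<close>

definition depth_sq :: "nat \<Rightarrow> node set set \<Rightarrow> real" where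
  "depth_sq m E = (\<Sum>w\<in>vertices m. (real (gdist E w root_node))\<^sup>2)"

text \<open>The division by zero at \<open>m = 0\<close> makes the first term \<open>0\<close>; any fixed start would do.\<close>

primrec wiener_centre :: "nat \<Rightarrow> real" where
  "wiener_centre 0 = 0"
| "wiener_centre (Suc m) = wiener_centre m * (1 + 2 / m) + 8 * m"

text \<open>The denominator solves \<open>x (m + 1) = x m * (1 + 2 / m)\<close>, so dividing by it
  removes the main growth factor of \<open>W\<close>, while the centre absorbs the drift
  \<open>8 * m\<close>.\<close>

definition normalized_wiener :: "nat \<Rightarrow> node set set \<Rightarrow> real" where
  "normalized_wiener m E = (wiener (vertices m, E) - wiener_centre m) / (m * (m + 1))"

lemma root_in_vertices: "m \<ge> 1 \<Longrightarrow> root_node \<in> vertices m"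
  by (simp add: root_node_def vertices_def)

lemma add4_sq_le: "(a + b + c + e)\<^sup>2 \<le> 4 * (a\<^sup>2 + b\<^sup>2 + c\<^sup>2 + e\<^sup>2)" for a b c e :: real
proof -
  have "4 * (a\<^sup>2 + b\<^sup>2 + c\<^sup>2 + e\<^sup>2) - (a + b + c + e)\<^sup>2 =
    (a - b)\<^sup>2 + (a - c)\<^sup>2 + (a - e)\<^sup>2 + (b - c)\<^sup>2 + (b - e)\<^sup>2 + (c - e)\<^sup>2"
    by (simp add: power2_eq_square algebra_simps)
  moreover have "\<dots> \<ge> 0" by simp
  ultimately show ?thesis by linarith
qed

section \<open>Conditional means of both indices, given the current tree\<close>

context
  fixes m :: nat and E :: "node set set"
  assumes m: "m \<ge> 1" and conn: "connected_graph (vertices m, E)"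
begin

private abbreviation "d x y \<equiv> real (gdist E x y)"
private abbreviation "D x \<equiv> (\<Sum>w\<in>vertices m. d x w)"
private abbreviation "W \<equiv> wiener (vertices m, E)"
private abbreviation "G \<equiv> weighted_wiener spin (vertices m, E)"

lemma connected_graph_grow:
  "u \<in> vertices m \<Longrightarrow> v \<in> vertices m \<Longrightarrow> connected_graph (vertices (Suc m), grow m E u v)"
  unfolding vertices_Suc grow_def by (rule add_two_leaves(1)[OF conn]) auto

lemma weighted_wiener_grow:
  assumes "u \<in> vertices m" "v \<in> vertices m"
  shows "weighted_wiener s (vertices (Suc m), grow m E u v) = weighted_wiener s (vertices m, E)
      + 2 * s (Suc m, TypeA) * (\<Sum>w\<in>vertices m. s w * (d u w + 1))
      + 2 * s (Suc m, TypeB) * (\<Sum>w\<in>vertices m. s w * (d v w + 1))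
      + 2 * s (Suc m, TypeA) * s (Suc m, TypeB) * (d u v + 2)"
  unfolding vertices_Suc grow_def
  by (rule weighted_wiener_add_two_leaves[OF conn]) (use assms in auto)

lemma wiener_grow:
  assumes "u \<in> vertices m" "v \<in> vertices m"
  shows "wiener (vertices (Suc m), grow m E u v) = W + 2 * (D u + D v) + 2 * d u v + (8 * m + 4)"
  unfolding weighted_wiener_grow[OF assms] by (simp add: sum.distrib)

text \<open>The \<open>+ 1\<close> contributions vanish because the old spins sum to 0; the new
  nodes have opposite spins, hence the signs.\<close>

lemma spin_wiener_grow:
  assumes "u \<in> vertices m" "v \<in> vertices m"
  shows "weighted_wiener spin (vertices (Suc m), grow m E u v) =
    G + 2 * ((\<Sum>w\<in>vertices m. spin w * d u w) - (\<Sum>w\<in>vertices m. spin w * d v w))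
      + (-2) * d u v + (-4)"
  unfolding weighted_wiener_grow[OF assms]
  by (simp add: sum.distrib distrib_left spin_def[of "(Suc m, _)"])

lemma parent_avg_wiener:
  "parent_avg \<theta> m (\<lambda>u v. wiener (vertices (Suc m), grow m E u v)) =
    W * (1 + 2 / m + 1 / (2 * (real m)\<^sup>2)) - \<theta>\<^sup>2 * G / (2 * (real m)\<^sup>2) + 8 * m + 4"
proof -
  have "parent_avg \<theta> m (\<lambda>u v. wiener (vertices (Suc m), grow m E u v)) =
     parent_avg \<theta> m (\<lambda>u v. W + 2 * (D u + D v) + 2 * d u v + (8 * m + 4))"
    using wiener_grow by (rule parent_avg_cong)
  also have "\<dots> = W + 2 * (sum D (vertices m) / m) + 2 * ((W - \<theta>\<^sup>2 * G) / (4 * (real m)\<^sup>2)) + (8 * m + 4)"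
    using parent_avg_plus[OF m, of \<theta> D, unfolded parent_avg_add]
    unfolding parent_avg_add parent_avg_cmult parent_avg_const[OF m] parent_avg_gdist[OF m]
    by simp
  also have "sum D (vertices m) = W"
    by (simp add: weighted_wiener_def)
  also have "W + 2 * (W / m) + 2 * ((W - \<theta>\<^sup>2 * G) / (4 * (real m)\<^sup>2)) + (8 * m + 4) =
      W * (1 + 2 / m + 1 / (2 * (real m)\<^sup>2)) - \<theta>\<^sup>2 * G / (2 * (real m)\<^sup>2) + 8 * m + 4"
    using m by (simp add: field_simps)
  finally show ?thesis .
qed

text \<open>With \<open>parent_avg_wiener\<close> this closes the system: the conditional means of
  \<open>W\<close> and \<open>G\<close> are affine in \<open>W\<close> and \<open>G\<close>.\<close>

lemma parent_avg_spin_wiener: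
  "parent_avg \<theta> m (\<lambda>u v. weighted_wiener spin (vertices (Suc m), grow m E u v)) =
    G * (1 + 2 * \<theta> / m + \<theta>\<^sup>2 / (2 * (real m)\<^sup>2)) - W / (2 * (real m)\<^sup>2) - 4"
proof -
  have "parent_avg \<theta> m (\<lambda>u v. weighted_wiener spin (vertices (Suc m), grow m E u v)) =
     parent_avg \<theta> m (\<lambda>u v. G + 2 * ((\<Sum>w\<in>vertices m. spin w * d u w) - (\<Sum>w\<in>vertices m. spin w * d v w))
      + (-2) * d u v + (-4))"
    using spin_wiener_grow by (rule parent_avg_cong)
  also have "\<dots> = G + 2 * (\<theta> * (\<Sum>x\<in>vertices m. spin x * (\<Sum>w\<in>vertices m. spin w * d x w)) / m)
      + (-2) * ((W - \<theta>\<^sup>2 * G) / (4 * (real m)\<^sup>2)) + (-4)"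
    unfolding parent_avg_add parent_avg_cmult parent_avg_const[OF m] parent_avg_minus[OF m]
      parent_avg_gdist[OF m] by simp
  also have "(\<Sum>x\<in>vertices m. spin x * (\<Sum>w\<in>vertices m. spin w * d x w)) = G"
    by (simp add: weighted_wiener_def sum_distrib_left mult.assoc)
  also have "G + 2 * (\<theta> * G / m) + (-2) * ((W - \<theta>\<^sup>2 * G) / (4 * (real m)\<^sup>2)) + (-4) =
      G * (1 + 2 * \<theta> / m + \<theta>\<^sup>2 / (2 * (real m)\<^sup>2)) - W / (2 * (real m)\<^sup>2) - 4"
    using m by (simp add: field_simps)
  finally show ?thesis .
qed

section \<open>Conditional second moments, given the current tree\<close>

private abbreviation "h x \<equiv> d x root_node"
private abbreviation "Y \<equiv> normalized_wiener m E"
private abbreviation "P \<equiv> (\<Sum>w\<in>vertices m. h w)"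
private abbreviation "Q \<equiv> depth_sq m E"

private lemma root_node: "root_node \<in> vertices m"
  using m by (rule root_in_vertices)

private lemma tri: "x \<in> vertices m \<Longrightarrow> y \<in> vertices m \<Longrightarrow> z \<in> vertices m \<Longrightarrow> d x z \<le> d x y + d y z"
  using gdist_triangle[OF conn, of x y z] by simp

lemma depth_sq_grow:
  assumes uv: "u \<in> vertices m" "v \<in> vertices m"
  shows "depth_sq (Suc m) (grow m E u v) = Q + (h u + 1)\<^sup>2 + (h v + 1)\<^sup>2"
proof -
  note D = add_two_leaves[OF conn new_notin_vertices new_notin_vertices _ uv, of TypeA TypeB,
      folded grow_def]
  show ?thesis
    unfolding depth_sq_def vertices_Suc using D(2,3,4) root_node by (simp add: add.commute)
qed

text \<open>Absorbing the cross term of \<open>(h + 1)\<^sup>2\<close> costs a factor 3/2, so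
  \<open>depth_sq\<close> grows at most like \<open>m powr (3/2)\<close>. An exponent below 2 is
  what the later summation needs.\<close>

lemma parent_avg_depth_sq:
  assumes \<theta>: "\<bar>\<theta>\<bar> \<le> 1"
  shows "parent_avg \<theta> m (\<lambda>u v. depth_sq (Suc m) (grow m E u v)) \<le> Q * (1 + 3 / (2 * m)) + 6"
proof -
  have sq: "(t + 1)\<^sup>2 \<le> 3 / 2 * t\<^sup>2 + 3" for t :: real
    using zero_le_power2[of "t - 2"] by (simp add: power2_eq_square algebra_simps)
  have "parent_avg \<theta> m (\<lambda>u v. depth_sq (Suc m) (grow m E u v)) \<le>
      parent_avg \<theta> m (\<lambda>u v. 3 / 2 * ((h u)\<^sup>2 + (h v)\<^sup>2) + (Q + 6))"
  proof (rule parent_avg_mono[OF \<theta>])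
    fix u v assume "u \<in> vertices m" "v \<in> vertices m"
    then show "depth_sq (Suc m) (grow m E u v) \<le> 3 / 2 * ((h u)\<^sup>2 + (h v)\<^sup>2) + (Q + 6)"
      using sq[of "h u"] sq[of "h v"] depth_sq_grow[of u v] by (simp add: algebra_simps)
  qed
  also have "\<dots> = 3 / 2 * (Q / m) + (Q + 6)"
    using parent_avg_plus[OF m, of \<theta> "\<lambda>u. (h u)\<^sup>2", unfolded parent_avg_add]
    unfolding parent_avg_add parent_avg_cmult parent_avg_const[OF m] depth_sq_def by simp
  finally show ?thesis
    by (simp add: algebra_simps)
qed

text \<open>Moving the base point to the root changes each of the \<open>2 * m\<close> distances by
  at most \<open>h x\<close>.\<close>

private lemma D_root: "x \<in> vertices m \<Longrightarrow> \<bar>D x - D root_node\<bar> \<le> 2 * m * h x"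
proof -
  assume x: "x \<in> vertices m"
  have "\<bar>d x w - d root_node w\<bar> \<le> h x" if "w \<in> vertices m" for w
    using tri[OF x root_node that] tri[OF root_node x that] by (simp add: gdist_sym)
  then have "\<bar>\<Sum>w\<in>vertices m. d x w - d root_node w\<bar> \<le> (\<Sum>w\<in>vertices m. h x)"
    by (intro order.trans[OF sum_abs] sum_mono) auto
  then show ?thesis by (simp add: sum_subtractf)
qed

text \<open>\<open>W\<close> is the sum of the \<open>2 * m\<close> values \<open>D x\<close>, so
  summing the comparison with the root gives the bound.\<close>

private lemma W_root: "\<bar>2 * m * D root_node - W\<bar> \<le> 2 * m * P"
proof -
  have "2 * m * D root_node - W = (\<Sum>x\<in>vertices m. D root_node - D x)"
    by (simp add: sum_subtractf weighted_wiener_def)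
  also have "\<bar>\<dots>\<bar> \<le> (\<Sum>x\<in>vertices m. 2 * m * h x)"
    using D_root by (intro order.trans[OF sum_abs] sum_mono) (simp add: abs_minus_commute)
  finally show ?thesis by (simp add: sum_distrib_left)
qed

private lemma P_sq: "P\<^sup>2 \<le> 2 * m * Q"
  using sum_squared_le_sum_of_squares[of h "vertices m"] by (simp add: depth_sq_def mult_ac)

text \<open>Numerator of the increment of \<open>Y\<close>. The terms before
  \<open>2 * d u v\<close> average to 0 for every \<open>\<theta>\<close>, a martingale difference;
  \<open>2 * d u v + 4\<close> is the bias.\<close>

private definition "\<zeta> u v = 2 * (D u + D v) - 2 * W / m + 2 * d u v + 4"

private lemma normalized_wiener_grow:
  assumes "u \<in> vertices m" "v \<in> vertices m"
  shows "normalized_wiener (Suc m) (grow m E u v) = Y + \<zeta> u v / ((m + 1) * (m + 2))"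
proof -
  have "(W + 2 * S + 2 * e + (8 * x + 4) - (c * (1 + 2 / x) + 8 * x)) / ((x + 1) * (x + 2)) =
      (W - c) / (x * (x + 1)) + (2 * S - 2 * W / x + 2 * e + 4) / ((x + 1) * (x + 2))"
    if "x > 0" for S e c x :: real
    using that by (simp add: divide_simps) (simp add: algebra_simps)
  from this[of "real m" "D u + D v" "d u v" "wiener_centre m"] show ?thesis
    unfolding normalized_wiener_def wiener_grow[OF assms] \<zeta>_def
    using m by (simp add: algebra_simps)
qed

text \<open>Total distances are compared with that of the root, which cancels and leaves only
  depths.\<close>

private lemma zeta_sq:
  assumes uv: "u \<in> vertices m" "v \<in> vertices m"
  shows "(\<zeta> u v)\<^sup>2 \<le> 144 * (real m)\<^sup>2 * ((h u)\<^sup>2 + (h v)\<^sup>2) + 128 * m * Q + 64 * (real m)\<^sup>2"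
proof -
  have m1: "real m \<ge> 1" using m by simp
  \<comment> \<open>\<open>R\<close> contains \<open>4 * D root_node\<close>, balancing the two
    subtractions of \<open>2 * D root_node\<close> below.\<close>
  define R where "R = 2 / m * (2 * m * D root_node - W)"
  have "\<zeta> u v = 2 * (D u - D root_node) + 2 * (D v - D root_node) + R + 2 * d u v + 4"
    using m1 by (simp add: \<zeta>_def R_def field_simps)
  moreover have "\<bar>R\<bar> \<le> 4 * P"
  proof -
    have "\<bar>R\<bar> \<le> 2 / m * (2 * m * P)"
      unfolding R_def abs_mult using W_root by (intro mult_mono) auto
    then show ?thesis using m1 by simp
  qed
  moreover have "d u v \<le> m * h u + m * h v"
    using tri[OF uv(1) root_node uv(2)] mult_right_mono[OF m1, of "h u"] mult_right_mono[OF m1, of "h v"]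
    by (simp add: gdist_sym)
  moreover have "0 \<le> d u v" by simp
  \<comment> \<open>Scalar core, for \<open>x = m * h u\<close>, \<open>y = m * h v\<close>,
    \<open>p = P\<close>, \<open>k = m\<close>. The 6 is 2 * 2 from the total distances plus 2 from
    \<open>d u v\<close>.\<close>
  moreover have "\<bar>z\<bar> \<le> 6 * x + 6 * y + 4 * p + 4 * k"
    if "z = 2 * a + 2 * b + r + 2 * e + 4" "\<bar>r\<bar> \<le> 4 * p" "e \<le> x + y" "0 \<le> e"
      "\<bar>a\<bar> \<le> 2 * x" "\<bar>b\<bar> \<le> 2 * y" "1 \<le> k" for z a b r e x y p k :: real
    using that by linarith
  ultimately have "\<bar>\<zeta> u v\<bar> \<le> 6 * (m * h u) + 6 * (m * h v) + 4 * P + 4 * m"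
    using D_root[OF uv(1)] D_root[OF uv(2)] m1 unfolding of_nat_mult of_nat_numeral mult.assoc
    by blast
  then have "\<bar>\<zeta> u v\<bar> \<le> 6 * m * h u + 6 * m * h v + 4 * P + 4 * m"
    by (simp add: mult.assoc)
  then have "(\<zeta> u v)\<^sup>2 \<le> (6 * m * h u + 6 * m * h v + 4 * P + 4 * m)\<^sup>2"
    by (metis abs_ge_zero power2_abs power_mono)
  also have "\<dots> \<le> 4 * ((6 * m * h u)\<^sup>2 + (6 * m * h v)\<^sup>2 + (4 * P)\<^sup>2 + (4 * real m)\<^sup>2)"
    using add4_sq_le[of "6 * m * h u" "6 * m * h v" "4 * P" "4 * m"] by simp
  also have "\<dots> = 144 * (real m)\<^sup>2 * ((h u)\<^sup>2 + (h v)\<^sup>2) + 64 * P\<^sup>2 + 64 * (real m)\<^sup>2"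
    by (simp add: power_mult_distrib algebra_simps)
  finally show ?thesis using P_sq by linarith
qed

text \<open>Expand the square. The martingale cross term averages to 0, the bias cross term is split
  by Young's inequality, and \<open>zeta_sq\<close> bounds the rest by depths.\<close>

lemma parent_avg_normalized_wiener_sq:
  assumes \<theta>: "\<bar>\<theta>\<bar> \<le> 1"
  shows "parent_avg \<theta> m (\<lambda>u v. (normalized_wiener (Suc m) (grow m E u v))\<^sup>2)
    \<le> Y\<^sup>2 * (1 + 1 / (real m)\<^sup>2) + (288 * (Q / m) + 96) / (real m)\<^sup>2"
proof -
  define N :: real where "N = (m + 1) * (m + 2)"
  define M :: real where "M = (real m)\<^sup>2"
  have m0: "real m > 0" using m by simp
  have M0: "M > 0" and NM: "N \<ge> M"
    using m0 by (auto simp: M_def N_def power2_eq_square algebra_simps)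
  have N0: "N > 0" using M0 NM by linarith
  \<comment> \<open>Here 160 = 144 + 16 and 96 = 64 + 32 add the bounds for the squared increment
    and the bias. Averaging the depths later gives 288 = 160 + 128.\<close>
  define B where "B u v = Y\<^sup>2 * (1 + 1 / M) + (160 * ((h u)\<^sup>2 + (h v)\<^sup>2) + 128 * (Q / m) + 96) / M" for u v
  have pw: "(Y + \<zeta> u v / N)\<^sup>2 \<le> 2 * Y / N * (2 * (D u + D v) - 2 * W / m) + B u v"
    if uv: "u \<in> vertices m" "v \<in> vertices m" for u v
  proof -
    \<comment> \<open>Young's inequality with weight \<open>M\<close>: the factor on
      \<open>Y\<^sup>2\<close> exceeds 1 only by the summable \<open>1 / M\<close>.\<close>
    have "2 * Y * t \<le> Y\<^sup>2 / M + M * t\<^sup>2" for t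
    proof -
      have "0 \<le> (Y - M * t)\<^sup>2 / M" using M0 by simp
      also have "\<dots> = Y\<^sup>2 / M - 2 * Y * t + M * t\<^sup>2"
        using M0 by (simp add: power2_eq_square field_simps)
      finally show ?thesis by linarith
    qed
    from this[of "(2 * d u v + 4) / N"]
    have "2 * Y * ((2 * d u v + 4) / N) \<le> Y\<^sup>2 / M + M * ((2 * d u v + 4) / N)\<^sup>2" .
    moreover have "M * ((2 * d u v + 4) / N)\<^sup>2 \<le> (2 * d u v + 4)\<^sup>2 / M"
    proof -
      have "M * ((2 * d u v + 4) / N)\<^sup>2 = M * (2 * d u v + 4)\<^sup>2 / N\<^sup>2"
        by (simp add: power_divide)
      also have "\<dots> \<le> M * (2 * d u v + 4)\<^sup>2 / M\<^sup>2"
        using NM M0 by (intro divide_left_mono power_mono mult_pos_pos) auto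
      finally show ?thesis using M0 by (simp add: power2_eq_square)
    qed
    moreover have "(2 * d u v + 4)\<^sup>2 \<le> 16 * ((h u)\<^sup>2 + (h v)\<^sup>2) + 32"
    proof -
      have "(2 * d u v + 4)\<^sup>2 \<le> (2 * h u + 2 * h v + 2 + 2)\<^sup>2"
        using tri[OF uv(1) root_node uv(2)] by (intro power_mono) (auto simp: gdist_sym)
      also have "\<dots> \<le> 4 * ((2 * h u)\<^sup>2 + (2 * h v)\<^sup>2 + 2\<^sup>2 + 2\<^sup>2)"
        by (rule add4_sq_le)
      finally show ?thesis by (simp add: power_mult_distrib)
    qed
    moreover have "(\<zeta> u v / N)\<^sup>2 \<le> (144 * ((h u)\<^sup>2 + (h v)\<^sup>2) + 128 * (Q / m) + 64) / M"
    proof -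
      have "(\<zeta> u v / N)\<^sup>2 \<le> (144 * M * ((h u)\<^sup>2 + (h v)\<^sup>2) + 128 * m * Q + 64 * M) / M\<^sup>2"
        unfolding power_divide
        using zeta_sq[OF uv] order.trans[OF zero_le_power2 zeta_sq[OF uv]] NM M0
        by (intro frac_le power_mono) (auto simp: M_def)
      also have "\<dots> = (144 * ((h u)\<^sup>2 + (h v)\<^sup>2) + 128 * (Q / m) + 64) / M"
        using m0 unfolding M_def by (simp add: field_simps power2_eq_square)
      finally show ?thesis .
    qed
    moreover have "(Y + \<zeta> u v / N)\<^sup>2 = Y\<^sup>2 + 2 * Y / N * (2 * (D u + D v) - 2 * W / m)
        + 2 * Y * ((2 * d u v + 4) / N) + (\<zeta> u v / N)\<^sup>2"
    proof -
      have "(Y + (A + C) / N)\<^sup>2 = Y\<^sup>2 + 2 * Y / N * A + 2 * Y * (C / N) + ((A + C) / N)\<^sup>2" for A C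
        by (simp add: power2_eq_square add_divide_distrib algebra_simps)
      from this[of "2 * (D u + D v) - 2 * W / m" "2 * d u v + 4"] show ?thesis
        unfolding \<zeta>_def by (simp only: add.assoc)
    qed
    ultimately have "(Y + \<zeta> u v / N)\<^sup>2 \<le> Y\<^sup>2 + 2 * Y / N * (2 * (D u + D v) - 2 * W / m)
       + Y\<^sup>2 / M + (16 * ((h u)\<^sup>2 + (h v)\<^sup>2) + 32) / M
       + (144 * ((h u)\<^sup>2 + (h v)\<^sup>2) + 128 * (Q / m) + 64) / M"
      using divide_right_mono[of "(2 * d u v + 4)\<^sup>2" "16 * ((h u)\<^sup>2 + (h v)\<^sup>2) + 32" M] M0 by linarith
    then show ?thesis
      unfolding B_def by (simp add: algebra_simps add_divide_distrib)
  qed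
  have "parent_avg \<theta> m (\<lambda>u v. (normalized_wiener (Suc m) (grow m E u v))\<^sup>2) \<le>
     parent_avg \<theta> m (\<lambda>u v. 2 * Y / N * (2 * (D u + D v) + (- 2 * W / m)) + B u v)"
  proof (rule parent_avg_mono[OF \<theta>])
    fix u v assume uv: "u \<in> vertices m" "v \<in> vertices m"
    have "normalized_wiener (Suc m) (grow m E u v) = Y + \<zeta> u v / N"
      using normalized_wiener_grow[OF uv] by (simp add: N_def algebra_simps)
    then show "(normalized_wiener (Suc m) (grow m E u v))\<^sup>2 \<le>
        2 * Y / N * (2 * (D u + D v) + (- 2 * W / m)) + B u v"
      using pw[OF uv] by simp
  qed
  \<comment> \<open>The martingale part drops out, since \<open>D\<close> sums to
    \<open>W\<close>.\<close>
  also have "\<dots> = parent_avg \<theta> m B"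
    using parent_avg_plus[OF m, of \<theta> D, unfolded parent_avg_add]
    unfolding parent_avg_add parent_avg_cmult parent_avg_const[OF m]
    by (simp add: weighted_wiener_def algebra_simps)
  also have "\<dots> = parent_avg \<theta> m (\<lambda>u v. 160 / M * ((h u)\<^sup>2 + (h v)\<^sup>2) + (Y\<^sup>2 * (1 + 1 / M) + (128 * (Q / m) + 96) / M))"
    unfolding B_def by (rule parent_avg_cong) (simp add: add_divide_distrib)
  also have "\<dots> = 160 / M * (Q / m) + (Y\<^sup>2 * (1 + 1 / M) + (128 * (Q / m) + 96) / M)"
    using parent_avg_plus[OF m, of \<theta> "\<lambda>u. (h u)\<^sup>2"]
    unfolding parent_avg_add[of _ _ "\<lambda>u v. 160 / M * _ u v"] parent_avg_add[of _ _ _ "\<lambda>_ _. Y\<^sup>2 * (1 + 1 / M) + (128 * (Q / m) + 96) / M"]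
      parent_avg_cmult parent_avg_const[OF m] depth_sq_def by simp
  finally show ?thesis
    unfolding M_def by (simp add: add_divide_distrib)
qed

end

section \<open>Moments of the Wiener index\<close>

text \<open>All laws here have finite support, which settles integrability.\<close>

lemma expectation_bind_finite:
  fixes f :: "'b \<Rightarrow> real"
  assumes "finite (set_pmf p)" "\<And>x. x \<in> set_pmf p \<Longrightarrow> finite (set_pmf (k x))"
  shows "measure_pmf.expectation (p \<bind> k) f =
    measure_pmf.expectation p (\<lambda>x. measure_pmf.expectation (k x) f)"
  using assms by (subst pmf_expectation_bind) (auto simp: integral_measure_pmf[of "set_pmf p"])

lemma expectation_mono_finite:
  fixes f g :: "'a \<Rightarrow> real"
  assumes "finite (set_pmf p)" "\<And>x. x \<in> set_pmf p \<Longrightarrow> f x \<le> g x"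
  shows "measure_pmf.expectation p f \<le> measure_pmf.expectation p g"
  using assms by (auto intro!: integral_mono_AE integrable_measure_pmf_finite simp: AE_measure_pmf_iff)

lemma expectation_cong:
  fixes f g :: "'a \<Rightarrow> real"
  assumes "\<And>x. x \<in> set_pmf p \<Longrightarrow> f x = g x"
  shows "measure_pmf.expectation p f = measure_pmf.expectation p g"
  using assms by (intro integral_cong_AE) (auto simp: AE_measure_pmf_iff)

lemma finite_nodes_of_type [simp]: "finite (nodes_of_type m c)"
  by (simp add: nodes_of_type_def)

lemma nodes_of_type_nonempty [simp]: "m \<ge> 1 \<Longrightarrow> nodes_of_type m c \<noteq> {}"
  by (simp add: nodes_of_type_def)

lemma sum_nodes_of_type: "sum f (nodes_of_type m c) = (\<Sum>i=1..m. f (i, c))"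
  unfolding nodes_of_type_def sum.cartesian_product' by simp

lemma card_nodes_of_type [simp]: "card (nodes_of_type m c) = m"
  by (simp add: nodes_of_type_def card_cartesian_product)

definition parent_pmf :: "real \<Rightarrow> nat \<Rightarrow> community \<Rightarrow> node pmf" where
  "parent_pmf q m c = choose_type q c \<bind> (\<lambda>c'. pmf_of_set (nodes_of_type m c'))"

lemma finite_choose_type [simp]: "finite (set_pmf (choose_type q c))"
  by (rule finite_subset[of _ "{TypeA, TypeB}"]) (auto intro: community.exhaust)

lemma set_parent_pmf: "m \<ge> 1 \<Longrightarrow> set_pmf (parent_pmf q m c) \<subseteq> vertices m"
  by (auto simp: parent_pmf_def nodes_of_type_def vertices_def)

lemma finite_parent_pmf [simp]: "m \<ge> 1 \<Longrightarrow> finite (set_pmf (parent_pmf q m c))"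
  using finite_subset[OF set_parent_pmf finite_vertices] .

text \<open>The weights \<open>(1 - q) / m\<close> for the own type and \<open>q / m\<close> for the
  other are \<open>(1 + \<theta>) / (2 m)\<close> and \<open>(1 - \<theta>) / (2 m)\<close>; the
  product of spins selects the sign. The label \<open>m\<close> in \<open>spin (m, c)\<close> is
  arbitrary.\<close>

lemma expectation_parent_pmf:
  fixes f :: "node \<Rightarrow> real"
  assumes q: "0 \<le> q" "q \<le> 1" and m: "m \<ge> 1"
  shows "measure_pmf.expectation (parent_pmf q m c) f =
    (\<Sum>w\<in>vertices m. (1 + (1 - 2 * q) * (spin (m, c) * spin w)) / (2 * real m) * f w)"
proof -
  have "measure_pmf.expectation (parent_pmf q m c) f =
      (\<Sum>w\<in>nodes_of_type m (other c). f w) / m * q + (\<Sum>w\<in>nodes_of_type m c. f w) / m * (1 - q)"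
    unfolding parent_pmf_def
    using q m by (subst expectation_bind_finite) (auto simp: choose_type_def integral_pmf_of_set add_divide_distrib)
  also have "\<dots> = (\<Sum>w\<in>nodes_of_type m (other c). q / m * f w) +
      (\<Sum>w\<in>nodes_of_type m c. (1 - q) / m * f w)"
    unfolding sum_distrib_left[symmetric] by (simp only: divide_inverse mult_ac)
  also have "\<dots> = (\<Sum>w\<in>vertices m. (1 + (1 - 2 * q) * (spin (m, c) * spin w)) / (2 * real m) * f w)"
    unfolding sum_nodes_of_type sum_vertices sum.distrib[symmetric]
    using m by (intro sum.cong refl, cases c) (simp_all add: spin_def field_simps)
  finally show ?thesis .
qed

lemma bcmrt_edges_Suc:
  assumes "m \<ge> 1"
  shows "bcmrt_edges q (Suc m) = do {
     E \<leftarrow> bcmrt_edges q m;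
     u \<leftarrow> parent_pmf q m TypeA;
     v \<leftarrow> parent_pmf q m TypeB;
     return_pmf (grow m E u v)}"
proof -
  obtain k where k: "m = Suc k" using assms by (cases m) auto
  show ?thesis
    unfolding k bcmrt_edges.simps parent_pmf_def bind_assoc_pmf grow_def
    \<comment> \<open>The definition draws both types before either parent; independence lets the
      type choice for \<open>B\<close> move past \<open>u\<close>.\<close>
    by (subst bind_commute_pmf[of "choose_type q TypeB"]) simp
qed

lemma finite_bcmrt_edges [simp]: "finite (set_pmf (bcmrt_edges q n))"
proof (induction n)
  case (Suc n)
  show ?case
  proof (cases n)
    case (Suc k)
    then show ?thesis
      using Suc.IH by (subst bcmrt_edges_Suc) auto
  qed simp
qed simp

text \<open>Conditioning on the tree at time \<open>m\<close> turns each one-step average into a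
  recursion for expectations.\<close>

lemma expectation_bcmrt_edges_Suc:
  fixes f :: "node set set \<Rightarrow> real"
  assumes q: "0 \<le> q" "q \<le> 1" and m: "m \<ge> 1"
  shows "measure_pmf.expectation (bcmrt_edges q (Suc m)) f =
    measure_pmf.expectation (bcmrt_edges q m)
      (\<lambda>E. parent_avg (1 - 2 * q) m (\<lambda>u v. f (grow m E u v)))"
  unfolding bcmrt_edges_Suc[OF m]
  using m by (simp add: expectation_bind_finite expectation_parent_pmf[OF q m] parent_avg_def
      spin_def[of "(m, _)"] sum_distrib_left mult.assoc)

lemma vertices_one: "vertices 1 = {(1, TypeA), (1, TypeB)}"
  using vertices_Suc[of 0] by (simp add: vertices_def)

lemma graph_one:
  defines "E \<equiv> {{(1, TypeA), (1, TypeB)}} :: node set set"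
  shows "connected_graph (vertices 1, E)" and "gdist E (1, TypeA) (1, TypeB) = 1"
proof -
  have "connected_graph ({(1, TypeB)} :: node set, {})"
    by (auto simp: connected_graph_def intro: exI[of _ 0])
  note L = add_leaf[OF this, of "(1, TypeA)" "(1, TypeB)"]
  show "connected_graph (vertices 1, E)"
    unfolding vertices_one E_def using L(1) by simp
  show "gdist E (1, TypeA) (1, TypeB) = 1"
    using L(3)[of "(1, TypeB)"] by (simp add: E_def)
qed

lemma connected_graph_bcmrt:
  assumes "n \<ge> 1" "E \<in> set_pmf (bcmrt_edges q n)"
  shows "connected_graph (vertices n, E)"
  using assms
proof (induction n arbitrary: E rule: dec_induct)
  case base
  then show ?case using graph_one(1) by simp
next
  case (step m)
  then show ?case
    using set_parent_pmf[of m q] connected_graph_grow[of m] by (fastforce simp: bcmrt_edges_Suc)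
qed

lemma expectation_wiener_one:
  "measure_pmf.expectation (bcmrt_edges q 1) (\<lambda>E. wiener (vertices 1, E)) = 2"
  using graph_one(2) gdist_sym[of "{{(1, TypeA), (1, TypeB)}} :: node set set" "(1, TypeB)" "(1, TypeA)"]
  unfolding vertices_one by (simp add: weighted_wiener_def)

lemma expectation_spin_wiener_one:
  "measure_pmf.expectation (bcmrt_edges q 1) (\<lambda>E. weighted_wiener spin (vertices 1, E)) = - 2"
  using graph_one(2) gdist_sym[of "{{(1, TypeA), (1, TypeB)}} :: node set set" "(1, TypeB)" "(1, TypeA)"]
  unfolding vertices_one by (simp add: weighted_wiener_def spin_def)

lemma expectation_depth_sq_one:
  "measure_pmf.expectation (bcmrt_edges q 1) (depth_sq 1) = 1"
  using graph_one(2) gdist_sym[of "{{(1, TypeA), (1, TypeB)}} :: node set set" "(1, TypeB)" "(1, TypeA)"]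
  unfolding vertices_one depth_sq_def root_node_def by simp

lemma expectation_normalized_wiener_sq_one:
  "measure_pmf.expectation (bcmrt_edges q 1) (\<lambda>E. (normalized_wiener 1 E)\<^sup>2) = 1"
  using expectation_wiener_one[of q] by (simp add: normalized_wiener_def)

section \<open>Recursions for the moments\<close>

lemma expectation_wiener_Suc:
  assumes q: "0 \<le> q" "q \<le> 1" and m: "m \<ge> 1"
  shows "measure_pmf.expectation (bcmrt_edges q (Suc m)) (\<lambda>E. wiener (vertices (Suc m), E)) =
    measure_pmf.expectation (bcmrt_edges q m) (\<lambda>E. wiener (vertices m, E))
        * (1 + 2 / m + 1 / (2 * (real m)\<^sup>2))
      - (1 - 2 * q)\<^sup>2 * measure_pmf.expectation (bcmrt_edges q m)
          (\<lambda>E. weighted_wiener spin (vertices m, E)) / (2 * (real m)\<^sup>2) + 8 * m + 4"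
  unfolding expectation_bcmrt_edges_Suc[OF q m]
  by (subst expectation_cong[OF parent_avg_wiener[OF m connected_graph_bcmrt[OF m]]])
     (auto simp: integrable_measure_pmf_finite)

lemma expectation_spin_wiener_Suc:
  assumes q: "0 \<le> q" "q \<le> 1" and m: "m \<ge> 1"
  shows "measure_pmf.expectation (bcmrt_edges q (Suc m))
      (\<lambda>E. weighted_wiener spin (vertices (Suc m), E)) =
    measure_pmf.expectation (bcmrt_edges q m) (\<lambda>E. weighted_wiener spin (vertices m, E))
        * (1 + 2 * (1 - 2 * q) / m + (1 - 2 * q)\<^sup>2 / (2 * (real m)\<^sup>2))
      - measure_pmf.expectation (bcmrt_edges q m) (\<lambda>E. wiener (vertices m, E))
          / (2 * (real m)\<^sup>2) - 4"
  unfolding expectation_bcmrt_edges_Suc[OF q m]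
  by (subst expectation_cong[OF parent_avg_spin_wiener[OF m connected_graph_bcmrt[OF m]]])
     (auto simp: integrable_measure_pmf_finite)

lemma expectation_depth_sq_Suc:
  assumes q: "0 \<le> q" "q \<le> 1" and m: "m \<ge> 1"
  shows "measure_pmf.expectation (bcmrt_edges q (Suc m)) (depth_sq (Suc m)) \<le>
    measure_pmf.expectation (bcmrt_edges q m) (depth_sq m) * (1 + 3 / (2 * m)) + 6"
proof -
  have "measure_pmf.expectation (bcmrt_edges q (Suc m)) (depth_sq (Suc m)) \<le>
      measure_pmf.expectation (bcmrt_edges q m) (\<lambda>E. depth_sq m E * (1 + 3 / (2 * m)) + 6)"
    unfolding expectation_bcmrt_edges_Suc[OF q m]
    by (intro expectation_mono_finite parent_avg_depth_sq m connected_graph_bcmrt) (use q in auto)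
  then show ?thesis
    by (simp add: integrable_measure_pmf_finite)
qed

lemma expectation_normalized_wiener_sq_Suc:
  assumes q: "0 \<le> q" "q \<le> 1" and m: "m \<ge> 1"
  shows "measure_pmf.expectation (bcmrt_edges q (Suc m)) (\<lambda>E. (normalized_wiener (Suc m) E)\<^sup>2) \<le>
    measure_pmf.expectation (bcmrt_edges q m) (\<lambda>E. (normalized_wiener m E)\<^sup>2)
        * (1 + 1 / (real m)\<^sup>2)
      + (288 * (measure_pmf.expectation (bcmrt_edges q m) (depth_sq m) / m) + 96) / (real m)\<^sup>2"
proof -
  have "measure_pmf.expectation (bcmrt_edges q (Suc m)) (\<lambda>E. (normalized_wiener (Suc m) E)\<^sup>2) \<le>
      measure_pmf.expectation (bcmrt_edges q m) (\<lambda>E. (normalized_wiener m E)\<^sup>2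
        * (1 + 1 / (real m)\<^sup>2) + (288 * (depth_sq m E / m) + 96) / (real m)\<^sup>2)"
    unfolding expectation_bcmrt_edges_Suc[OF q m]
    by (intro expectation_mono_finite parent_avg_normalized_wiener_sq m connected_graph_bcmrt)
       (use q in auto)
  then show ?thesis
    by (simp add: integrable_measure_pmf_finite)
qed

section \<open>Uniform second-moment bound\<close>

text \<open>A discrete Gronwall bound: \<open>x + 1\<close> is multiplied by at most
  \<open>1 + \<gamma> m \<le> exp (\<gamma> m)\<close> in each step and starts at most at 2.\<close>

lemma exp_sum_bound:
  fixes x \<gamma> :: "nat \<Rightarrow> real"
  assumes "x 1 \<le> 1" "\<And>m. m \<ge> 1 \<Longrightarrow> 0 \<le> x m" "\<And>m. 0 \<le> \<gamma> m" "summable \<gamma>"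
    and step: "\<And>m. m \<ge> 1 \<Longrightarrow> x (Suc m) \<le> x m * (1 + \<gamma> m) + \<gamma> m" and n: "n \<ge> 1"
  shows "x n \<le> 2 * exp (suminf \<gamma>)"
proof -
  have "x n + 1 \<le> 2 * exp (sum \<gamma> {..<n})"
    using n
  proof (induction n rule: dec_induct)
    case base
    have "1 \<le> exp (sum \<gamma> {..<1})" using assms(3)[of 0] by simp
    then show ?case using assms(1) by linarith
  next
    case (step m)
    have "x (Suc m) + 1 \<le> (x m + 1) * (1 + \<gamma> m)"
      using assms(5)[OF step(1)] by (simp add: algebra_simps)
    also have "\<dots> \<le> (2 * exp (sum \<gamma> {..<m})) * exp (\<gamma> m)"
      using step.IH assms(2)[OF step(1)] assms(3)[of m] by (intro mult_mono exp_ge_add_one_self) auto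
    finally show ?case by (simp add: exp_add mult_ac)
  qed
  also have "\<dots> \<le> 2 * exp (suminf \<gamma>)"
    using assms(3,4) by (simp add: sum_le_suminf)
  finally show ?thesis by simp
qed

text \<open>The mean squared depth grows by the factor \<open>1 + 1 / (2 * (m + 1))\<close> plus
  \<open>6 / (m + 1)\<close>. The shift 12 makes the recursion homogeneous, \<open>sqrt\<close>
  dominates that factor, and 13 = 1 + 12 is the value at 1.\<close>

lemma expectation_depth_sq_le:
  assumes q: "0 \<le> q" "q \<le> 1" and n: "n \<ge> 1"
  shows "measure_pmf.expectation (bcmrt_edges q n) (depth_sq n) / n + 12 \<le> 13 * sqrt n"
  using n
proof (induction n rule: dec_induct)
  case base
  then show ?case using expectation_depth_sq_one[of q] by simp
next
  case (step m)
  define z where "z n = measure_pmf.expectation (bcmrt_edges q n) (depth_sq n) / n" for n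
  have m: "real m > 0" using step by simp
  have z: "measure_pmf.expectation (bcmrt_edges q k) (depth_sq k) = k * z k" if "k \<ge> 1" for k
    using that by (simp add: z_def)
  have "Suc m * z (Suc m) \<le> m * z m * (1 + 3 / (2 * m)) + 6"
    using expectation_depth_sq_Suc[OF q step(1)] unfolding z[OF step(1)] z[of "Suc m", simplified] by simp
  also have "\<dots> = Suc m * (z m * (1 + 1 / (2 * (real m + 1))) + 6 / (real m + 1))"
  proof -
    have "x * y * (1 + 3 / (2 * x)) + 6 = (x + 1) * (y * (1 + 1 / (2 * (x + 1))) + 6 / (x + 1))"
      if "x > 0" for x y :: real
      using that by (simp add: divide_simps) (simp add: algebra_simps)
    from this[OF m, of "z m"] show ?thesis by (simp add: add.commute)
  qed
  finally have "z (Suc m) \<le> z m * (1 + 1 / (2 * (real m + 1))) + 6 / (real m + 1)"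
    by (subst (asm) mult_le_cancel_left_pos) auto
  moreover have "12 * (1 / (2 * (real m + 1))) = 6 / (real m + 1)"
    using m by (simp add: divide_simps)
  ultimately have "z (Suc m) + 12 \<le> (z m + 12) * (1 + 1 / (2 * (real m + 1)))"
    unfolding distrib_left distrib_right mult_1_right by linarith
  also have "\<dots> \<le> 13 * sqrt m * (1 + 1 / (2 * (real m + 1)))"
    using step.IH m unfolding z_def by (intro mult_right_mono) auto
  also have "\<dots> \<le> 13 * sqrt (Suc m)"
  proof -
    have "(sqrt m * (1 + 1 / (2 * (real m + 1))))\<^sup>2 \<le> real (Suc m)"
      unfolding power_mult_distrib using m
      by (simp add: power2_eq_square divide_simps) (simp add: algebra_simps)
    then show ?thesis
      using real_le_rsqrt by (simp add: mult.assoc)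
  qed
  finally show ?case by (simp add: z_def)
qed

text \<open>The recursion has coefficients free of \<open>q\<close>, so one \<open>K\<close> serves
  all \<open>q\<close> and \<open>n\<close>.\<close>

lemma normalized_wiener_sq_bound:
  obtains K where "K > 0" "\<And>q n. 0 \<le> q \<Longrightarrow> q \<le> 1 \<Longrightarrow> n \<ge> 1 \<Longrightarrow>
    measure_pmf.expectation (bcmrt_edges q n) (\<lambda>E. (normalized_wiener n E)\<^sup>2) \<le> K"
proof
  \<comment> \<open>3840 = 288 * 13 + 96, from the depth bound \<open>13 * sqrt m\<close> and
    \<open>1 \<le> sqrt m\<close>; the power is \<open>sqrt m / m\<^sup>2\<close>.\<close>
  define \<gamma> :: "nat \<Rightarrow> real" where "\<gamma> m = 3840 * (real m powr (-3/2))" for m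
  have \<gamma>: "summable \<gamma>"
    unfolding \<gamma>_def by (intro summable_mult) (simp add: summable_real_powr_iff)
  show "2 * exp (suminf \<gamma>) > 0" by simp
  fix q :: real and n :: nat
  assume q: "0 \<le> q" "q \<le> 1" and n: "n \<ge> 1"
  define x where "x n = measure_pmf.expectation (bcmrt_edges q n) (\<lambda>E. (normalized_wiener n E)\<^sup>2)" for n
  have "x (Suc m) \<le> x m * (1 + \<gamma> m) + \<gamma> m" if m: "m \<ge> 1" for m
  proof -
    have m1: "real m \<ge> 1" using m by simp
    have s1: "sqrt m \<ge> 1" using m1 by simp
    have \<gamma>m: "\<gamma> m = 3840 * sqrt m / (real m)\<^sup>2"
    proof -
      have "real m powr (-3/2) = real m powr (1/2) / real m powr 2"
        using powr_diff[of "real m" "1/2" 2] by simp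
      then show ?thesis
        using m1 by (simp add: \<gamma>_def powr_half_sqrt)
    qed
    have "x (Suc m) \<le> x m * (1 + 1 / (real m)\<^sup>2)
        + (288 * (measure_pmf.expectation (bcmrt_edges q m) (depth_sq m) / m) + 96) / (real m)\<^sup>2"
      unfolding x_def by (rule expectation_normalized_wiener_sq_Suc[OF q m])
    also have "\<dots> \<le> x m * (1 + \<gamma> m) + \<gamma> m"
    proof (intro add_mono mult_left_mono)
      show "1 / (real m)\<^sup>2 \<le> \<gamma> m"
        unfolding \<gamma>m
      proof (rule divide_right_mono)
        show "1 \<le> 3840 * sqrt m" using s1 by linarith
      qed simp
      show "(288 * (measure_pmf.expectation (bcmrt_edges q m) (depth_sq m) / m) + 96) / (real m)\<^sup>2 \<le> \<gamma> m"
        unfolding \<gamma>m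
      proof (rule divide_right_mono)
        show "288 * (measure_pmf.expectation (bcmrt_edges q m) (depth_sq m) / m) + 96 \<le> 3840 * sqrt m"
          using s1 expectation_depth_sq_le[OF q m] by linarith
      qed simp
      show "0 \<le> x m" by (simp add: x_def)
    qed simp
    finally show ?thesis .
  qed
  moreover have "x 1 \<le> 1" "\<And>m. 0 \<le> x m" "\<And>m. 0 \<le> \<gamma> m"
    using expectation_normalized_wiener_sq_one[of q] by (simp_all add: x_def \<gamma>_def)
  ultimately have "x n \<le> 2 * exp (suminf \<gamma>)"
    using n \<gamma> by (intro exp_sum_bound) auto
  then show "measure_pmf.expectation (bcmrt_edges q n) (\<lambda>E. (normalized_wiener n E)\<^sup>2) \<le> 2 * exp (suminf \<gamma>)"
    by (simp add: x_def)
qed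

section \<open>Separation of the means\<close>

text \<open>The gap opens at \<open>n = 2\<close> through the \<open>\<theta>\<^sup>2\<close> term,
  and the factor \<open>1 + 2 / m\<close> then carries it along in proportion to
  \<open>n * (n + 1)\<close>.\<close>

lemma expectation_wiener_diff:
  assumes q: "0 \<le> q0" "q0 < q1" "q1 \<le> 1 / 2" and n: "n \<ge> 2"
  shows "((1 - 2 * q0)\<^sup>2 - (1 - 2 * q1)\<^sup>2) / 6 * (n * (n + 1)) \<le>
    measure_pmf.expectation (bcmrt_edges q0 n) (\<lambda>E. wiener (vertices n, E))
    - measure_pmf.expectation (bcmrt_edges q1 n) (\<lambda>E. wiener (vertices n, E))"
proof -
  define a where "a q n = measure_pmf.expectation (bcmrt_edges q n) (\<lambda>E. wiener (vertices n, E))" for q n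
  define g where "g q n = - measure_pmf.expectation (bcmrt_edges q n)
    (\<lambda>E. weighted_wiener spin (vertices n, E))" for q n
  define \<theta> where "\<theta> q = 1 - 2 * q" for q :: real
  \<comment> \<open>The 6 is \<open>n * (n + 1)\<close> at \<open>n = 2\<close>.\<close>
  define \<delta> where "\<delta> = ((\<theta> q0)\<^sup>2 - (\<theta> q1)\<^sup>2) / 6"
  have \<theta>: "0 \<le> \<theta> q1" "\<theta> q1 \<le> \<theta> q0" using q by (auto simp: \<theta>_def)
  have \<theta>2: "(\<theta> q1)\<^sup>2 \<le> (\<theta> q0)\<^sup>2" using \<theta> by (simp add: power_mono)
  have a: "a r (Suc m) = a r m * (1 + 2 / m + 1 / (2 * (real m)\<^sup>2))
      + (\<theta> r)\<^sup>2 * g r m / (2 * (real m)\<^sup>2) + 8 * m + 4"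
    if "m \<ge> 1" "r \<in> {q0, q1}" for r m
    using expectation_wiener_Suc[of r m] that q by (auto simp: a_def g_def \<theta>_def)
  have g: "g r (Suc m) = g r m * (1 + 2 * \<theta> r / m + (\<theta> r)\<^sup>2 / (2 * (real m)\<^sup>2))
      + a r m / (2 * (real m)\<^sup>2) + 4"
    if "m \<ge> 1" "r \<in> {q0, q1}" for r m
    using expectation_spin_wiener_Suc[of r m] that q by (auto simp: a_def g_def \<theta>_def)
  have one: "a r 1 = 2" "g r 1 = 2" for r
    unfolding a_def g_def expectation_wiener_one expectation_spin_wiener_one by auto
  \<comment> \<open>With \<open>g\<close> in place of \<open>G\<close> all coefficients are
    nonnegative and, for \<open>0 \<le> \<theta>\<close>, nondecreasing in \<open>\<theta>\<close>,
    so the order between \<open>q1\<close> and \<open>q0\<close> propagates.\<close>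
  have mono: "0 \<le> a q1 m \<and> a q1 m \<le> a q0 m \<and> 0 \<le> g q1 m \<and> g q1 m \<le> g q0 m" if "m \<ge> 1" for m
    using that
  proof (induction m rule: dec_induct)
    case base
    then show ?case using one by simp
  next
    case (step m)
    have "a q1 (Suc m) \<le> a q0 (Suc m)"
      unfolding a[OF step(1) insertI1] a[OF step(1) insertI2[OF insertI1]]
      using step.IH \<theta>2 by (intro add_mono mult_mono divide_right_mono) auto
    moreover have "g q1 (Suc m) \<le> g q0 (Suc m)"
      unfolding g[OF step(1) insertI1] g[OF step(1) insertI2[OF insertI1]]
      using step.IH \<theta>2 \<theta> by (intro add_mono mult_mono divide_right_mono) auto
    moreover have "0 \<le> a q1 (Suc m)" "0 \<le> g q1 (Suc m)"
      unfolding a[OF step(1) insertI2[OF insertI1]] g[OF step(1) insertI2[OF insertI1]]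
      using step.IH \<theta> by auto
    ultimately show ?case by simp
  qed
  have "\<delta> * (n * (n + 1)) \<le> a q0 n - a q1 n"
    using n
  proof (induction n rule: dec_induct)
    case base
    have "a q0 2 - a q1 2 = (\<theta> q0)\<^sup>2 - (\<theta> q1)\<^sup>2"
      using a[of 1 q0] a[of 1 q1] one by (simp add: numeral_2_eq_2)
    then show ?case by (simp add: \<delta>_def)
  next
    case (step m)
    then have m: "m \<ge> 1" by simp
    have "\<delta> * (Suc m * (Suc m + 1)) = \<delta> * (m * (m + 1)) * (1 + 2 / m)"
      using m by (simp add: field_simps)
    also have "\<dots> \<le> (a q0 m - a q1 m) * (1 + 2 / m)"
      using step.IH by (intro mult_right_mono) auto
    \<comment> \<open>Only the factor \<open>1 + 2 / m\<close> is kept; by \<open>mono\<close> the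
      other differences are nonnegative.\<close>
    also have "\<dots> \<le> a q0 (Suc m) - a q1 (Suc m)"
    proof -
      have "(\<theta> q1)\<^sup>2 * g q1 m / (2 * (real m)\<^sup>2) \<le> (\<theta> q0)\<^sup>2 * g q0 m / (2 * (real m)\<^sup>2)"
        using mono[OF m] \<theta>2 by (intro divide_right_mono mult_mono) auto
      moreover have "a q1 m * (1 / (2 * (real m)\<^sup>2)) \<le> a q0 m * (1 / (2 * (real m)\<^sup>2))"
        using mono[OF m] by (intro mult_right_mono) auto
      ultimately show ?thesis
        unfolding a[OF m insertI1] a[OF m insertI2[OF insertI1]] by (simp only: ring_distribs)
    qed
    finally show ?case .
  qed
  then show ?thesis
    unfolding a_def \<delta>_def \<theta>_def by (simp only: of_nat_mult of_nat_add of_nat_1)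
qed

text \<open>The centre is the same for both parameters and cancels.\<close>

lemma expectation_normalized_wiener_diff:
  assumes q: "0 \<le> q0" "q0 < q1" "q1 \<le> 1 / 2" and n: "n \<ge> 2"
  shows "((1 - 2 * q0)\<^sup>2 - (1 - 2 * q1)\<^sup>2) / 6 \<le>
    measure_pmf.expectation (bcmrt_edges q0 n) (normalized_wiener n)
    - measure_pmf.expectation (bcmrt_edges q1 n) (normalized_wiener n)"
proof -
  have eq: "measure_pmf.expectation (bcmrt_edges q n) (normalized_wiener n) =
    (measure_pmf.expectation (bcmrt_edges q n) (\<lambda>E. wiener (vertices n, E)) - wiener_centre n)
      / real (n * (n + 1))" for q
    unfolding normalized_wiener_def by (simp add: integrable_measure_pmf_finite)
  have pos: "real (n * (n + 1)) > 0"
    unfolding of_nat_0_less_iff using n by (cases n) simp_all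
  show ?thesis
    using expectation_wiener_diff[OF q n]
    unfolding eq diff_divide_distrib[symmetric] pos_le_divide_eq[OF pos]
    by (simp only: of_nat_mult of_nat_add of_nat_1)
qed

section \<open>The test\<close>

text \<open>The mean gap is the sum of \<open>s t * f t\<close>. Young's inequality and
  \<open>\<bar>s t\<bar> \<le> pmf P0 t + pmf P1 t\<close> bound the L1 distance of the laws below
  by \<open>\<delta>\<^sup>2 / (2 * K)\<close>, and the likelihood ratio test has error sum 1 minus
  half that distance.\<close>

lemma two_point_test:
  fixes P0 P1 :: "'a pmf" and f :: "'a \<Rightarrow> real"
  assumes fin: "finite (set_pmf P0)" "finite (set_pmf P1)" and \<delta>: "\<delta> > 0" and K: "K > 0"
    and sq: "measure_pmf.expectation P0 (\<lambda>t. (f t)\<^sup>2) \<le> K" "measure_pmf.expectation P1 (\<lambda>t. (f t)\<^sup>2) \<le> K"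
    and diff: "\<delta> \<le> measure_pmf.expectation P0 f - measure_pmf.expectation P1 f"
  obtains \<phi> where "measure_pmf.prob P0 {t. \<phi> t} + measure_pmf.prob P1 {t. \<not> \<phi> t} \<le> 1 - \<delta>\<^sup>2 / (4 * K)"
proof
  define S where "S = set_pmf P0 \<union> set_pmf P1"
  define \<phi> where "\<phi> t \<longleftrightarrow> pmf P0 t < pmf P1 t" for t
  have S: "finite S" using fin by (simp add: S_def)
  have ex: "measure_pmf.expectation P h = (\<Sum>t\<in>S. pmf P t * h t)" if "P \<in> {P0, P1}" for P and h :: "'a \<Rightarrow> real"
    using that by (subst integral_measure_pmf[OF S]) (auto simp: S_def)
  have pr: "measure_pmf.prob P A = (\<Sum>t\<in>S. pmf P t * indicator A t)" if "P \<in> {P0, P1}" for P A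
    using ex[OF that, of "indicator A"] by simp
  define s where "s t = pmf P0 t - pmf P1 t" for t
  \<comment> \<open>This value maximizes the resulting lower bound
    \<open>2 * c * (\<delta> - c * K)\<close>.\<close>
  define c where "c = \<delta> / (2 * K)"
  have c: "c > 0" using \<delta> K by (simp add: c_def)
  have amgm: "s t * f t \<le> c / 2 * (pmf P0 t * (f t)\<^sup>2 + pmf P1 t * (f t)\<^sup>2) + 1 / (2 * c) * \<bar>s t\<bar>" for t
  proof -
    have "0 \<le> (c * \<bar>f t\<bar> - 1)\<^sup>2 / (2 * c)" using c by simp
    also have "\<dots> = c / 2 * (f t)\<^sup>2 + 1 / (2 * c) - \<bar>f t\<bar>"
      using c by (simp add: power2_eq_square field_simps)
    finally have "\<bar>s t\<bar> * \<bar>f t\<bar> \<le> \<bar>s t\<bar> * (c / 2 * (f t)\<^sup>2 + 1 / (2 * c))"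
      by (intro mult_left_mono) auto
    moreover have "\<bar>s t\<bar> * (c / 2 * (f t)\<^sup>2) \<le> (pmf P0 t + pmf P1 t) * (c / 2 * (f t)\<^sup>2)"
      using c by (intro mult_right_mono) (auto simp: s_def abs_le_iff)
    moreover have "s t * f t \<le> \<bar>s t\<bar> * \<bar>f t\<bar>"
      by (metis abs_ge_self abs_mult)
    ultimately show ?thesis
      by (simp add: algebra_simps)
  qed
  have "\<delta> \<le> (\<Sum>t\<in>S. s t * f t)"
    using diff by (simp add: ex s_def sum_subtractf left_diff_distrib)
  also have "\<dots> \<le> (\<Sum>t\<in>S. c / 2 * (pmf P0 t * (f t)\<^sup>2 + pmf P1 t * (f t)\<^sup>2) + 1 / (2 * c) * \<bar>s t\<bar>)"
    by (rule sum_mono) (rule amgm)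
  also have "\<dots> = c / 2 * (measure_pmf.expectation P0 (\<lambda>t. (f t)\<^sup>2) + measure_pmf.expectation P1 (\<lambda>t. (f t)\<^sup>2))
      + 1 / (2 * c) * (\<Sum>t\<in>S. \<bar>s t\<bar>)"
    by (simp add: ex sum.distrib flip: sum_distrib_left sum_divide_distrib)
  also have "\<dots> \<le> c / 2 * (K + K) + 1 / (2 * c) * (\<Sum>t\<in>S. \<bar>s t\<bar>)"
    using sq c by (intro add_right_mono mult_left_mono add_mono) auto
  finally have "\<delta> \<le> c * K + (\<Sum>t\<in>S. \<bar>s t\<bar>) / (2 * c)" by simp
  moreover have "c * K = \<delta> / 2" using K by (simp add: c_def)
  ultimately have "\<delta> / 2 \<le> (\<Sum>t\<in>S. \<bar>s t\<bar>) / (2 * c)" by linarith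
  then have "\<delta> * c \<le> (\<Sum>t\<in>S. \<bar>s t\<bar>)"
    using c by (simp add: field_simps)
  then have tv: "\<delta>\<^sup>2 / (2 * K) \<le> (\<Sum>t\<in>S. \<bar>s t\<bar>)"
    by (simp add: c_def power2_eq_square)
  have "measure_pmf.prob P0 UNIV + measure_pmf.prob P1 UNIV = 2" by simp
  then have total: "(\<Sum>t\<in>S. pmf P0 t + pmf P1 t) = 2"
    by (simp only: pr insert_iff simp_thms indicator_UNIV mult_1_right sum.distrib)
  \<comment> \<open>At each point the test pays the smaller mass, and twice the minimum is the sum
    minus the absolute difference.\<close>
  have "2 * (measure_pmf.prob P0 {t. \<phi> t} + measure_pmf.prob P1 {t. \<not> \<phi> t}) =
      (\<Sum>t\<in>S. (pmf P0 t + pmf P1 t) - \<bar>s t\<bar>)"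
    unfolding pr[of P0, simplified] pr[of P1, simplified] sum.distrib[symmetric] sum_distrib_left
    by (intro sum.cong refl) (simp add: \<phi>_def s_def indicator_def)
  also have "\<dots> \<le> 2 - \<delta>\<^sup>2 / (2 * K)"
    using tv total by (simp add: sum_subtractf)
  finally show "measure_pmf.prob P0 {t. \<phi> t} + measure_pmf.prob P1 {t. \<not> \<phi> t} \<le> 1 - \<delta>\<^sup>2 / (4 * K)"
    by simp
qed

section \<open>The statistic on isomorphism classes\<close>

text \<open>Any representative serves, since \<open>wiener\<close> is an isomorphism
  invariant.\<close>

definition class_statistic :: "nat \<Rightarrow> node graph set \<Rightarrow> real" where
  "class_statistic n t = (wiener (SOME H. H \<in> t) - wiener_centre n) / (n * (n + 1))"

lemma class_statistic_unlabelled: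
  assumes "connected_graph (vertices n, E)"
  shows "class_statistic n (unlabelled (vertices n, E)) = normalized_wiener n E"
proof -
  let ?G = "(vertices n, E)"
  have "?G \<in> unlabelled ?G"
    by (auto simp: unlabelled_def graph_isomorphic_def intro!: exI[of _ id])
  then have "(SOME H. H \<in> unlabelled ?G) \<in> unlabelled ?G" by (rule someI)
  then have "wiener (SOME H. H \<in> unlabelled ?G) = wiener ?G"
    using assms by (intro wiener_isomorphic) (auto simp: unlabelled_def connected_graph_def)
  then show ?thesis
    by (simp add: class_statistic_def normalized_wiener_def)
qed

text \<open>The function \<open>h\<close> covers both the mean and the second moment.\<close>

lemma expectation_class_statistic:
  fixes h :: "real \<Rightarrow> real"
  assumes "n \<ge> 1"
  shows "measure_pmf.expectation (unlabelled_bcmrt q n) (\<lambda>t. h (class_statistic n t)) =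
    measure_pmf.expectation (bcmrt_edges q n) (\<lambda>E. h (normalized_wiener n E))"
  unfolding unlabelled_bcmrt_def bcmrt_def map_pmf_comp integral_map_pmf
  using class_statistic_unlabelled[OF connected_graph_bcmrt[OF assms]]
  by (intro expectation_cong) (auto simp: vertices_def)

lemma finite_unlabelled_bcmrt: "finite (set_pmf (unlabelled_bcmrt q n))"
  by (simp add: unlabelled_bcmrt_def bcmrt_def)

theorem theorem11:
  fixes q0 q1 :: real
  assumes "0 \<le> q0" and "q0 < q1" and "q1 \<le> 1 / 2"
  shows "(SUP n\<in>{2..}. optimal_risk q0 q1 n) < 1 / 2"
proof -
  obtain K where K: "K > 0" and bound: "\<And>q n. 0 \<le> q \<Longrightarrow> q \<le> 1 \<Longrightarrow> n \<ge> 1 \<Longrightarrow>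
    measure_pmf.expectation (bcmrt_edges q n) (\<lambda>E. (normalized_wiener n E)\<^sup>2) \<le> K"
    by (rule normalized_wiener_sq_bound) blast
  define \<delta> where "\<delta> = ((1 - 2 * q0)\<^sup>2 - (1 - 2 * q1)\<^sup>2) / 6"
  have \<delta>: "\<delta> > 0"
    using assms by (simp add: \<delta>_def power_strict_mono)
  \<comment> \<open>The bound does not involve \<open>n\<close>, so strictness survives the
    supremum.\<close>
  have "optimal_risk q0 q1 n \<le> 1 / 2 * (1 - \<delta>\<^sup>2 / (4 * K))" if "n \<in> {2..}" for n
  proof -
    have n: "n \<ge> 1" "n \<ge> 2" using that by auto
    obtain \<phi> where "measure_pmf.prob (unlabelled_bcmrt q0 n) {t. \<phi> t}
        + measure_pmf.prob (unlabelled_bcmrt q1 n) {t. \<not> \<phi> t} \<le> 1 - \<delta>\<^sup>2 / (4 * K)"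
    proof (rule two_point_test[OF finite_unlabelled_bcmrt finite_unlabelled_bcmrt \<delta> K])
      show "measure_pmf.expectation (unlabelled_bcmrt q0 n) (\<lambda>t. (class_statistic n t)\<^sup>2) \<le> K"
        "measure_pmf.expectation (unlabelled_bcmrt q1 n) (\<lambda>t. (class_statistic n t)\<^sup>2) \<le> K"
        unfolding expectation_class_statistic[OF n(1), of _ "\<lambda>x. x\<^sup>2"]
        using assms n by (auto intro!: bound)
      show "\<delta> \<le> measure_pmf.expectation (unlabelled_bcmrt q0 n) (class_statistic n)
          - measure_pmf.expectation (unlabelled_bcmrt q1 n) (class_statistic n)"
        using expectation_normalized_wiener_diff[OF assms n(2)]
        unfolding expectation_class_statistic[OF n(1), of _ "\<lambda>x. x"] \<delta>_def .
    qed
    then have "risk q0 q1 n \<phi> \<le> 1 / 2 * (1 - \<delta>\<^sup>2 / (4 * K))"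
      by (simp add: risk_def)
    moreover have "optimal_risk q0 q1 n \<le> risk q0 q1 n \<phi>"
      unfolding optimal_risk_def by (rule cINF_lower[OF bdd_below_risk]) simp
    ultimately show ?thesis by (rule order.trans[rotated])
  qed
  then have "(SUP n\<in>{2..}. optimal_risk q0 q1 n) \<le> 1 / 2 * (1 - \<delta>\<^sup>2 / (4 * K))"
    by (intro cSUP_least) auto
  also have "\<dots> < 1 / 2"
    using \<delta> K by simp
  finally show ?thesis .
qed

end
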